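(* There exists a universal constant $C>0$ such that for every integer $d\ge2$, every $n\ge2$ of the form $n=n_1^d$ with $n_1\in\mathbb{N}$, and every $\theta_0\in\mathbb{R}^{\mathbb{L}_{d,n}}$ (not necessarily isotonic), \[ R(\hat\theta_n,\theta_0)\le\inf_{\theta\in\mathcal{M}(\mathbb{L}_{d,n})}\biggl\{\frac{\|\theta-\theta_0\|_2^2}{n}+\frac{C K(\theta)}{n}\log_+^8\Bigl(\frac{n}{K(\theta)}\Bigr)\biggr\}. \]
   Context: For $n=n_1^d$, $\mathbb{L}_{d,n}:=\{1,\ldots,n_1\}^d$, partially ordered by $u\preceq v$ iff $u_j\le v_j$ for all $j$. $\mathcal{M}(\mathbb{L}_{d,n}):=\{\theta\in\mathbb{R}^{\mathbb{L}_{d,n}}:\theta_u\le\theta_v\text{ whenever }u\preceq v\}$. One observes $Y=(Y_w)_{w\in\mathbb{L}_{d,n}}$ with $Y_w=(\theta_0)_w+\epsilon_w$, where the $\epsilon_w$ are independent $N(0,1)$; $\hat\theta_n$ is the Euclidean projection of $Y$ onto $\mathcal{M}(\mathbb{L}_{d,n})$ (the least squares estimator), and $R(\hat\theta_n,\theta_0):=\mathbb{E}\bigl[\frac1n\|\hat\theta_n-\theta_0\|_2^2\bigr]$. A subset $A\subseteq\mathbb{L}_{d,n}$ is a two-dimensional sheet if $A=\mathbb{L}_{d,n}\cap\prod_{j=1}^d[a_j,b_j]$ with $|\{j:a_j=b_j\}|\ge d-2$. For $\theta\in\mathcal{M}(\mathbb{L}_{d,n})$, $K(\theta)$ is the smallest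 $K$ such that $\mathbb{L}_{d,n}$ can be partitioned into $K$ two-dimensional sheets $A_1,\ldots,A_K$ with $\theta$ constant on each $A_\ell$. $\log_+(x):=\log(\max(x,e))$. "Universal" means not depending on $d$, $n$ or anything else. *)

theory Defs
  imports "HOL-Probability.Probability"
begin

(* The dimension d varies within one statement, so points are functions on {1..d} and vectors
   are functions on the lattice. Both are taken extensional (undefined outside their domain),
   so that a vector is determined by its coordinates. *)

definition lattice_points :: "nat \<Rightarrow> nat \<Rightarrow> (nat \<Rightarrow> nat) set" where
  "lattice_points d n1 = {1..d} \<rightarrow>\<^sub>E {1..n1}"

definition lattice_le :: "nat \<Rightarrow> (nat \<Rightarrow> nat) \<Rightarrow> (nat \<Rightarrow> nat) \<Rightarrow> bool" where
  "lattice_le d u v \<longleftrightarrow> (\<forall>j\<in>{1..d}. u j \<le> v j)"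

definition lattice_vectors :: "nat \<Rightarrow> nat \<Rightarrow> ((nat \<Rightarrow> nat) \<Rightarrow> real) set" where
  "lattice_vectors d n1 = lattice_points d n1 \<rightarrow>\<^sub>E (UNIV :: real set)"

definition isotonic :: "nat \<Rightarrow> nat \<Rightarrow> ((nat \<Rightarrow> nat) \<Rightarrow> real) set" where
  "isotonic d n1 = {\<theta> \<in> lattice_vectors d n1.
     \<forall>u\<in>lattice_points d n1. \<forall>v\<in>lattice_points d n1. lattice_le d u v \<longrightarrow> \<theta> u \<le> \<theta> v}"

definition lattice_norm ::
  "nat \<Rightarrow> nat \<Rightarrow> ((nat \<Rightarrow> nat) \<Rightarrow> real) \<Rightarrow> real" where
  "lattice_norm d n1 x = L2_set x (lattice_points d n1)"

definition lse ::
  "nat \<Rightarrow> nat \<Rightarrow> ((nat \<Rightarrow> nat) \<Rightarrow> real) \<Rightarrow> (nat \<Rightarrow> nat) \<Rightarrow> real" where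
  "lse d n1 y = (THE \<theta>. is_arg_min (\<lambda>\<theta>. lattice_norm d n1 (\<lambda>w. \<theta> w - y w))
                           (\<lambda>\<theta>. \<theta> \<in> isotonic d n1) \<theta>)"

(* Joint law of independent N(0,1) variables indexed by the lattice. *)

definition gaussian_noise :: "nat \<Rightarrow> nat \<Rightarrow> ((nat \<Rightarrow> nat) \<Rightarrow> real) measure" where
  "gaussian_noise d n1 =
     (\<Pi>\<^sub>M w\<in>lattice_points d n1. density lborel (\<lambda>x. ennreal (std_normal_density x)))"

(* The integrand is integrable because the projection is 1-Lipschitz, so the default value 0
   of the Bochner integral never arises. *)

definition risk :: "nat \<Rightarrow> nat \<Rightarrow> ((nat \<Rightarrow> nat) \<Rightarrow> real) \<Rightarrow> real" where
  "risk d n1 \<theta>0 = (LINT \<epsilon>|gaussian_noise d n1.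
     (lattice_norm d n1
        (\<lambda>w. lse d n1 (\<lambda>v\<in>lattice_points d n1. \<theta>0 v + \<epsilon> v) w - \<theta>0 w))\<^sup>2 / real (n1 ^ d))"

definition two_dim_sheet :: "nat \<Rightarrow> nat \<Rightarrow> (nat \<Rightarrow> nat) set \<Rightarrow> bool" where
  "two_dim_sheet d n1 A \<longleftrightarrow> (\<exists>a b :: nat \<Rightarrow> real.
     A = {w \<in> lattice_points d n1. \<forall>j\<in>{1..d}. real (w j) \<in> {a j..b j}} \<and>
     card {j \<in> {1..d}. a j = b j} \<ge> d - 2)"

(* For d >= 2 singletons are two-dimensional sheets, so the minimum is over a nonempty set. *)

definition sheet_complexity :: "nat \<Rightarrow> nat \<Rightarrow> ((nat \<Rightarrow> nat) \<Rightarrow> real) \<Rightarrow> nat" where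
  "sheet_complexity d n1 \<theta> = (LEAST K. \<exists>P. partition_on (lattice_points d n1) P \<and>
     finite P \<and> card P = K \<and> (\<forall>A\<in>P. two_dim_sheet d n1 A \<and> \<theta> constant_on A))"

definition log_plus :: "real \<Rightarrow> real" where
  "log_plus x = ln (max x (exp 1))"

end

theory Submission
  imports Defs
begin

text \<open>
  The theorem is an oracle inequality for projection onto a convex cone, combined with a bound on
  how well an isotonic function on a two-dimensional grid can correlate with white noise.

  \<^emph>\<open>Reduction to sheets.\<close> Let \<open>h\<close> be the least squares estimator minus a competitor \<open>\<theta>\<close>. The
  variational inequality of the projection (\<open>least_squares_variational\<close>) gives
  \<open>|est - \<theta>0|^2 \<le> |\<theta> - \<theta>0|^2 + 2 <\<epsilon>, h> - |h|^2\<close> with leading constant one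
  (\<open>least_squares_oracle\<close>). The last two terms are sums over the cells of any partition. If \<open>\<theta>\<close> is
  constant on a sheet then \<open>h\<close> is isotonic there, and a nonempty sheet is order isomorphic to a
  rectangular grid (\<open>two_dim_sheet_parametrization\<close>). So it suffices to bound
  \<open>2 <\<epsilon>, h> - |h|^2\<close> over all isotonic \<open>h\<close> on one grid.

  \<^emph>\<open>One grid.\<close> Let \<open>Z\<close> be the largest value of \<open>|sum of \<epsilon> over R| / sqrt |R|\<close> over all rectangles \<open>R\<close>
  of a grid with \<open>m\<close> points. Pathwise, \<open>|<\<epsilon>, h>| \<le> C (1 + log m)^3 Z |h|\<close> for every isotonic \<open>h\<close>
  (\<open>isotone_sum_bound\<close>); so the supremum over the whole cone is controlled by polynomially many
  Gaussian variables. Split \<open>h\<close> into positive and negative parts and reflect one of them, to arrive at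
  a nonnegative antitone \<open>g\<close>. On the dyadic block of size \<open>2^a\<close> by \<open>2^b\<close> whose lower corner is
  \<open>(2^a - 1, 2^b - 1)\<close>, monotonicity forces \<open>g \<le> |g| / sqrt (2^(a+b))\<close>; there are about
  \<open>log^2 m\<close> blocks. Inside a block, \<open>g\<close> is approximated on finer and finer dyadic cells by its value
  at the lower corner of the cell. When the cells are halved in one direction, the increments of the
  corner values along a row telescope to at most \<open>max g\<close>, and halving the two directions in turn keeps
  the number of rows small compared with the size of the cells. Each halving costs at most \<open>|g| Z\<close>
  (\<open>cell_sum_halve\<close>, \<open>block_bound\<close>), and there are about \<open>log m\<close> of them.

  \<^emph>\<open>Adding up.\<close> By completing the square, the noise term of one sheet is at most
  \<open>C (1 + log m)^6 Z^2\<close>, and \<open>Z^2\<close> has a majorant of expectation of order \<open>1 + log m\<close>, because the square of a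
  standard normal variable has a finite exponential moment (\<open>grid_noise_envelope\<close>). The powers of the
  logarithm are summed over the sheets by a concavity argument (\<open>sum_log_power_le\<close>).
\<close>

section \<open>Monotone functions on a dyadic block of the plane\<close>

definition rect_sum :: "(nat \<Rightarrow> nat \<Rightarrow> real) \<Rightarrow> nat \<Rightarrow> nat \<Rightarrow> nat \<Rightarrow> nat \<Rightarrow> real" where
  "rect_sum e x0 x1 y0 y1 = (\<Sum>x=x0..<x1. \<Sum>y=y0..<y1. e x y)"

text \<open>
  The width and the height may be zero, and the rectangle may lie anywhere in the quadrant: the
  dyadic cells met below stick out of the grid, and the noise is extended by zero.
\<close>

definition rect_bounded :: "(nat \<Rightarrow> nat \<Rightarrow> real) \<Rightarrow> real \<Rightarrow> bool" where
  "rect_bounded e Z \<longleftrightarrow> Z \<ge> 0 \<and>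
     (\<forall>x0 w y0 h. \<bar>rect_sum e x0 (x0 + w) y0 (y0 + h)\<bar> \<le> Z * sqrt (real w * real h))"

definition antitone2 :: "(nat \<Rightarrow> nat \<Rightarrow> real) \<Rightarrow> bool" where
  "antitone2 g \<longleftrightarrow> (\<forall>x x' y y'. x \<le> x' \<longrightarrow> y \<le> y' \<longrightarrow> g x' y' \<le> g x y)"

text \<open>
  The pairing of \<open>e\<close> with the step function that takes, on each of the \<open>P * Q\<close> cells of size
  \<open>w\<close> by \<open>h\<close>, the value of \<open>g\<close> at the lower corner of the cell. Corner values, unlike cell
  averages, turn refinement into a telescoping sum along rows.
\<close>

definition cell_sum ::
  "(nat \<Rightarrow> nat \<Rightarrow> real) \<Rightarrow> (nat \<Rightarrow> nat \<Rightarrow> real) \<Rightarrow> nat \<Rightarrow> nat \<Rightarrow> nat \<Rightarrow> nat \<Rightarrow> real" where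
  "cell_sum e g P w Q h =
     (\<Sum>p<P. \<Sum>q<Q. g (p * w) (q * h) * rect_sum e (p * w) (p * w + w) (q * h) (q * h + h))"

lemma rect_sum_transpose: "rect_sum (\<lambda>x y. e y x) x0 x1 y0 y1 = rect_sum e y0 y1 x0 x1"
  unfolding rect_sum_def by (rule sum.swap)

lemma rect_bounded_transpose:
  assumes "rect_bounded e Z" shows "rect_bounded (\<lambda>x y. e y x) Z"
  using assms unfolding rect_bounded_def rect_sum_transpose[of e] by (metis mult.commute)

lemma cell_sum_transpose:
  "cell_sum (\<lambda>x y. e y x) (\<lambda>x y. g y x) P w Q h = cell_sum e g Q h P w"
  unfolding cell_sum_def rect_sum_transpose[of e] by (rule sum.swap)

lemma rect_sum_split:
  "rect_sum e x0 (x0 + v) y0 y1 + rect_sum e (x0 + v) (x0 + v + w) y0 y1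
     = rect_sum e x0 (x0 + v + w) y0 y1"
  unfolding rect_sum_def by (simp add: sum.atLeastLessThan_concat)

lemma sum_pairs: "(\<Sum>p<2 * N. F p) = (\<Sum>p<N. F (2 * p) + F (2 * p + 1))"
  for F :: "nat \<Rightarrow> real"
  by (induction N) (simp_all add: algebra_simps)

text \<open>
  The even-to-odd decrements are half of the terms of a telescoping sum of nonnegative terms.
\<close>

lemma sum_alternate_decrements_le:
  fixes G :: "nat \<Rightarrow> real"
  assumes "\<And>p. G (Suc p) \<le> G p"
  shows "(\<Sum>p<N. G (2 * p) - G (2 * p + 1)) \<le> G 0 - G (2 * N)"
proof (induction N)
  case (Suc N)
  then show ?case using assms[of "2 * N + 1"] by simp
qed simp

text \<open>
  Halving the cells horizontally changes the step function only on the right halves, where the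
  value at the corner of the parent cell is replaced by the value at the midpoint of its base.
  Along one row these decrements add up to at most \<open>g 0 0\<close>, however many cells there are, and each is
  multiplied by the noise in one half cell. Hence the number of rows, not of cells, enters the bound.
\<close>

lemma cell_sum_halve:
  assumes e: "rect_bounded e Z" and g: "antitone2 g" and nonneg: "\<And>x y. 0 \<le> g x y"
  shows "\<bar>cell_sum e g (2 * P) w Q h - cell_sum e g P (2 * w) Q h\<bar>
           \<le> real Q * (g 0 0 * Z * sqrt (real w * real h))"
proof -
  define \<rho> where "\<rho> = Z * sqrt (real w * real h)"
  have rho: "\<bar>rect_sum e x0 (x0 + w) y0 (y0 + h)\<bar> \<le> \<rho>" for x0 y0
    using e unfolding rect_bounded_def \<rho>_def by blast
  have rho0: "\<rho> \<ge> 0" using e unfolding rect_bounded_def \<rho>_def by simp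
  define R where "R p q = rect_sum e (p * w) (p * w + w) (q * h) (q * h + h)" for p q
  have R2: "rect_sum e (p * (2 * w)) (p * (2 * w) + 2 * w) (q * h) (q * h + h)
              = R (2 * p) q + R (2 * p + 1) q" for p q
    using rect_sum_split[of e "2 * p * w" w "q * h" "q * h + h" w]
    unfolding R_def by (simp add: algebra_simps mult_2)
  have double: "p * (2 * w) = 2 * p * w" for p :: nat by simp
  have dec: "g (p * w) (q * h) \<ge> g (Suc p * w) (q * h)" for p q
    using g unfolding antitone2_def by simp
  have "cell_sum e g (2 * P) w Q h - cell_sum e g P (2 * w) Q h
      = (\<Sum>p<P. \<Sum>q<Q. (g ((2 * p + 1) * w) (q * h) - g (2 * p * w) (q * h)) * R (2 * p + 1) q)"
    unfolding cell_sum_def R2 sum_pairs R_def[symmetric] sum_subtractf[symmetric] sum.distrib[symmetric]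
    by (intro sum.cong refl) (unfold double, algebra)
  also have "\<dots> = (\<Sum>q<Q. \<Sum>p<P. (g ((2 * p + 1) * w) (q * h) - g (2 * p * w) (q * h)) * R (2 * p + 1) q)"
    by (rule sum.swap)
  also have "\<bar>\<dots>\<bar> \<le> (\<Sum>q<Q. g 0 0 * \<rho>)"
  proof (rule order_trans[OF sum_abs], rule sum_mono)
    fix q
    have "\<bar>\<Sum>p<P. (g ((2 * p + 1) * w) (q * h) - g (2 * p * w) (q * h)) * R (2 * p + 1) q\<bar>
       \<le> (\<Sum>p<P. (g (2 * p * w) (q * h) - g ((2 * p + 1) * w) (q * h)) * \<rho>)"
    proof (rule order_trans[OF sum_abs], rule sum_mono)
      fix p
      have "\<bar>R (2 * p + 1) q\<bar> \<le> \<rho>" unfolding R_def by (rule rho)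
      moreover have "g ((2 * p + 1) * w) (q * h) \<le> g (2 * p * w) (q * h)"
        using dec[of "2 * p" q] by simp
      ultimately show "\<bar>(g ((2 * p + 1) * w) (q * h) - g (2 * p * w) (q * h)) * R (2 * p + 1) q\<bar>
          \<le> (g (2 * p * w) (q * h) - g ((2 * p + 1) * w) (q * h)) * \<rho>"
        unfolding abs_mult by (intro mult_mono) auto
    qed
    also have "\<dots> = (\<Sum>p<P. g (2 * p * w) (q * h) - g ((2 * p + 1) * w) (q * h)) * \<rho>"
      by (rule sum_distrib_right[symmetric])
    also have "\<dots> \<le> (g (0 * w) (q * h) - g (2 * P * w) (q * h)) * \<rho>"
      using sum_alternate_decrements_le[of "\<lambda>p. g (p * w) (q * h)" P] dec rho0
      by (intro mult_right_mono) auto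
    also have "\<dots> \<le> g 0 0 * \<rho>"
    proof (rule mult_right_mono[OF _ rho0])
      have "g (0 * w) (q * h) \<le> g 0 0" using g unfolding antitone2_def by simp
      then show "g (0 * w) (q * h) - g (2 * P * w) (q * h) \<le> g 0 0"
        using nonneg[of "2 * P * w" "q * h"] by linarith
    qed
    finally show "\<bar>\<Sum>p<P. (g ((2 * p + 1) * w) (q * h) - g (2 * p * w) (q * h)) * R (2 * p + 1) q\<bar>
        \<le> g 0 0 * \<rho>" .
  qed
  finally show ?thesis by (simp add: \<rho>_def mult.assoc)
qed

text \<open>
  With \<open>2^i\<close> columns and \<open>2^j\<close> rows, halving the columns costs \<open>2^j\<close> times the square root of the size of
  the new cells, which is \<open>sqrt (2^(a + b))\<close> times \<open>2^((j - i - 1) / 2)\<close>. The rows must therefore be at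
  most as fine as the new columns.
\<close>

lemma halving_cost:
  assumes "i < a" "j \<le> b" "j \<le> Suc i" and vZ: "0 \<le> v * Z"
  shows "real (2 ^ j) * (v * Z * sqrt (real (2 ^ (a - Suc i)) * real (2 ^ (b - j))))
           \<le> v * Z * sqrt (2 ^ (a + b))"
proof -
  define s t where "s = a - Suc i" and "t = b - j"
  have st: "j + j + s + t \<le> a + b" unfolding s_def t_def using assms(1-3) by linarith
  have "real (2 ^ j) * sqrt (real (2 ^ s) * real (2 ^ t)) = sqrt ((2 ^ j)\<^sup>2) * sqrt (2 ^ s * 2 ^ t)"
    by simp
  also have "\<dots> = sqrt (2 ^ (j + j + s + t))"
    unfolding real_sqrt_mult[symmetric] by (simp add: power_add power2_eq_square mult.assoc)
  also have "\<dots> \<le> sqrt (2 ^ (a + b))"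
    by (rule real_sqrt_le_mono, rule power_increasing[OF st]) simp
  finally have "v * Z * (real (2 ^ j) * sqrt (real (2 ^ s) * real (2 ^ t)))
      \<le> v * Z * sqrt (2 ^ (a + b))" using vZ by (rule mult_left_mono)
  then show ?thesis unfolding s_def t_def by (simp only: mult.left_commute[of "real (2 ^ j)"])
qed

text \<open>
  Refine from the single cell to unit cells along the states with \<open>2^(min k a)\<close> columns and
  \<open>2^(min k b)\<close> rows. Each state is reached from the previous one by at most one halving in each
  direction, and each halving costs at most what also bounds the sum for the coarsest step function.
\<close>

lemma block_bound:
  assumes e: "rect_bounded e Z" and g: "antitone2 g" and nonneg: "\<And>x y. 0 \<le> g x y"
  shows "\<bar>\<Sum>x<2^a. \<Sum>y<2^b. g x y * e x y\<bar>
           \<le> (2 * real (max a b) + 1) * (g 0 0 * Z * sqrt (2 ^ (a + b)))"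
proof -
  define B where "B = g 0 0 * Z * sqrt (2 ^ (a + b))"
  define S where "S i j = cell_sum e g (2 ^ i) (2 ^ (a - i)) (2 ^ j) (2 ^ (b - j))" for i j
  have vZ: "0 \<le> g 0 0 * Z" using e nonneg[of 0 0] unfolding rect_bounded_def by (intro mult_nonneg_nonneg) blast+
  have B: "0 \<le> B" unfolding B_def using vZ by simp
  have stepX: "\<bar>S (Suc i) j - S i j\<bar> \<le> B" if "i < a" "j \<le> b" "j \<le> Suc i" for i j
  proof -
    have eq: "(2::nat) ^ (a - i) = 2 * 2 ^ (a - Suc i)" using that(1)
      by (simp add: Suc_diff_Suc flip: power_Suc)
    show ?thesis
      using cell_sum_halve[OF e g nonneg, of "2 ^ i" "2 ^ (a - Suc i)" "2 ^ j" "2 ^ (b - j)"]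
        halving_cost[OF that vZ]
      unfolding S_def B_def eq power_Suc by linarith
  qed
  have gT: "antitone2 (\<lambda>x y. g y x)" using g unfolding antitone2_def by blast
  have stepY: "\<bar>S i (Suc j) - S i j\<bar> \<le> B" if "j < b" "i \<le> a" "i \<le> Suc j" for i j
  proof -
    have eq: "(2::nat) ^ (b - j) = 2 * 2 ^ (b - Suc j)" using that(1)
      by (simp add: Suc_diff_Suc flip: power_Suc)
    show ?thesis
      using cell_sum_halve[OF rect_bounded_transpose[OF e] gT nonneg,
          of "2 ^ j" "2 ^ (b - Suc j)" "2 ^ i" "2 ^ (a - i)"]
        halving_cost[OF that vZ]
      unfolding S_def B_def eq power_Suc cell_sum_transpose[of e g] add.commute[of b a] by linarith
  qed
  have path: "\<bar>S (min k a) (min k b) - S 0 0\<bar> \<le> 2 * real k * B" for k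
  proof (induction k)
    case (Suc k)
    have 1: "\<bar>S (min (Suc k) a) (min k b) - S (min k a) (min k b)\<bar> \<le> B"
    proof (cases "k < a")
      case True
      then have "min (Suc k) a = Suc k" "min k a = k" by auto
      with stepX[OF True min.cobounded2, of k] show ?thesis by (simp only: min.coboundedI1 le_SucI le_refl)
    next
      case False
      then have "min (Suc k) a = a" "min k a = a" by auto
      then show ?thesis using B by (simp only: diff_self abs_zero)
    qed
    have 2: "\<bar>S (min (Suc k) a) (min (Suc k) b) - S (min (Suc k) a) (min k b)\<bar> \<le> B"
    proof (cases "k < b")
      case True
      then have "min (Suc k) b = Suc k" "min k b = k" by auto
      with stepY[OF True, of "min (Suc k) a"] show ?thesis by (simp only: min.cobounded1 min.cobounded2)
    next
      case False
      then have "min (Suc k) b = b" "min k b = b" by auto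
      then show ?thesis using B by (simp only: diff_self abs_zero)
    qed
    have "2 * real (Suc k) * B = 2 * real k * B + B + B" by (simp add: algebra_simps)
    moreover have tri: "\<bar>r - c\<bar> \<le> D + B + B"
      if "\<bar>q - p\<bar> \<le> B" "\<bar>r - q\<bar> \<le> B" "\<bar>p - c\<bar> \<le> D" for p q r c D :: real
      using that by linarith
    ultimately show ?case using tri[OF 1 2 Suc] by (simp only:)
  qed simp
  have fine: "S a b = (\<Sum>x<2^a. \<Sum>y<2^b. g x y * e x y)"
    unfolding S_def cell_sum_def rect_sum_def by simp
  have "S 0 0 = g 0 0 * rect_sum e 0 (0 + 2 ^ a) 0 (0 + 2 ^ b)"
    unfolding S_def cell_sum_def by simp
  moreover have "\<bar>rect_sum e 0 (0 + 2 ^ a) 0 (0 + 2 ^ b)\<bar> \<le> Z * sqrt (2 ^ (a + b))"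
    using e unfolding rect_bounded_def by (metis of_nat_numeral of_nat_power power_add)
  ultimately have coarse: "\<bar>S 0 0\<bar> \<le> B"
    unfolding B_def abs_mult using nonneg[of 0 0] by (simp add: abs_mult mult_left_mono mult.assoc)
  have "\<bar>S a b - S 0 0\<bar> \<le> 2 * real (max a b) * B"
    using path[of "max a b"] unfolding min_absorb2[OF max.cobounded1] min_absorb2[OF max.cobounded2] .
  then have "\<bar>S a b\<bar> \<le> (2 * real (max a b) + 1) * B"
    using coarse unfolding distrib_right mult_1_left
    by (smt (verit, best))
  then show ?thesis unfolding fine B_def .
qed

section \<open>Monotone functions on a grid\<close>

lemma sum_dyadic_shells:
  fixes F :: "nat \<Rightarrow> real"
  shows "(\<Sum>x<2 ^ A - 1. F x) = (\<Sum>a<A. \<Sum>i<2 ^ a. F (2 ^ a - 1 + i))"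
proof (induction A)
  case (Suc A)
  have split: "(\<Sum>x<n + m. F x) = (\<Sum>x<n. F x) + (\<Sum>i<m. F (n + i))" for n m
    by (induction m) simp_all
  have "(2::nat) ^ Suc A - 1 = (2 ^ A - 1) + 2 ^ A"
    using one_le_power[of "2::nat" A] by simp
  then have "(\<Sum>x<2 ^ Suc A - 1. F x) = (\<Sum>x<2 ^ A - 1. F x) + (\<Sum>i<2 ^ A. F (2 ^ A - 1 + i))"
    by (simp only: split)
  then show ?case using Suc by simp
qed simp

lemma rect_bounded_shift:
  assumes "rect_bounded e Z" shows "rect_bounded (\<lambda>x y. e (u + x) (v + y)) Z"
proof -
  have sh: "(\<Sum>x=a..<b. F (u + x)) = (\<Sum>x=u + a..<u + b. F x)" for F :: "nat \<Rightarrow> real" and a b u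
    by (simp add: sum.shift_bounds_nat_ivl[symmetric] add.commute)
  have "rect_sum (\<lambda>x y. e (u + x) (v + y)) x0 (x0 + w) y0 (y0 + h)
      = rect_sum e (u + x0) ((u + x0) + w) (v + y0) ((v + y0) + h)" for x0 w y0 h
    unfolding rect_sum_def
    using sh[of "\<lambda>x. \<Sum>y=y0..<y0 + h. e x (v + y)" u] sh[of _ v] by (simp add: add.assoc)
  then show ?thesis using assms unfolding rect_bounded_def by simp
qed

text \<open>
  All points below the corner carry at least the value at the corner, so their contribution to the
  squared norm is at least the squared value times their number.
\<close>

lemma antitone_corner_le:
  assumes g: "antitone2 g" and nonneg: "\<And>x y. 0 \<le> g x y"
    and supp: "\<And>x y. g x y \<noteq> 0 \<Longrightarrow> x < m1 \<and> y < m2"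
  shows "g (2 ^ a - 1) (2 ^ b - 1) * sqrt (2 ^ (a + b)) \<le> sqrt (\<Sum>x<m1. \<Sum>y<m2. (g x y)\<^sup>2)"
proof -
  define c where "c = g (2 ^ a - 1) (2 ^ b - 1)"
  define X Y where "X = {..<2 ^ a :: nat} \<times> {..<2 ^ b :: nat}" and "Y = {..<m1} \<times> {..<m2}"
  have "c\<^sup>2 * 2 ^ (a + b) = (\<Sum>p\<in>X. c\<^sup>2)" unfolding X_def by (simp add: power_add)
  also have "\<dots> \<le> (\<Sum>(x, y)\<in>X. (g x y)\<^sup>2)"
  proof (rule sum_mono, clarify)
    fix x y assume "(x, y) \<in> X"
    then have "x \<le> 2 ^ a - 1" "y \<le> 2 ^ b - 1" unfolding X_def by auto
    then have "c \<le> g x y" using g unfolding antitone2_def c_def by blast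
    then show "c\<^sup>2 \<le> (g x y)\<^sup>2" using nonneg unfolding c_def by (intro power_mono)
  qed
  also have "\<dots> = (\<Sum>(x, y)\<in>X \<inter> Y. (g x y)\<^sup>2)"
    using supp by (intro sum.mono_neutral_right) (auto simp: X_def Y_def)
  also have "\<dots> \<le> (\<Sum>(x, y)\<in>Y. (g x y)\<^sup>2)"
    by (intro sum_mono2) (auto simp: Y_def)
  also have "\<dots> = (\<Sum>x<m1. \<Sum>y<m2. (g x y)\<^sup>2)" unfolding Y_def by (rule sum.cartesian_product[symmetric])
  finally have "sqrt (c\<^sup>2 * 2 ^ (a + b)) \<le> sqrt (\<Sum>x<m1. \<Sum>y<m2. (g x y)\<^sup>2)"
    by (rule real_sqrt_le_mono)
  moreover have "sqrt (c\<^sup>2 * 2 ^ (a + b)) = c * sqrt (2 ^ (a + b))"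
    using nonneg unfolding c_def by (simp only: real_sqrt_mult real_sqrt_abs abs_of_nonneg)
  ultimately show ?thesis unfolding c_def by (simp only:)
qed

lemma dyadic_exponent:
  assumes "1 \<le> (m::nat)"
  obtains A where "m \<le> 2 ^ A - 1" "1 \<le> A" "real A \<le> 1 + log 2 (real m)"
proof -
  obtain n where n: "2 ^ n \<le> m" "m < 2 ^ (n + 1)" using ex_power_ivl1[of 2 m] assms by auto
  have "real (2 ^ n) \<le> real m" using n(1) by (simp only: of_nat_le_iff)
  then have "real n \<le> log 2 (real m)" by (intro le_log_of_power) simp_all
  with n show ?thesis by (intro that[of "n + 1"]) auto
qed

text \<open>
  The blocks with lower corners \<open>(2^a - 1, 2^b - 1)\<close> tile the quadrant. On each of them the corner value
  is at most the norm divided by the root of the block size, which cancels the block size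
  in \<open>block_bound\<close>. One factor \<open>1 + log 2 m\<close> counts the halvings in a block, two count the blocks.
\<close>

lemma antitone_sum_bound:
  assumes e: "rect_bounded e Z" and g: "antitone2 g" and nonneg: "\<And>x y. 0 \<le> g x y"
    and supp: "\<And>x y. g x y \<noteq> 0 \<Longrightarrow> x < m1 \<and> y < m2" and m: "1 \<le> m1" "1 \<le> m2"
  shows "\<bar>\<Sum>x<m1. \<Sum>y<m2. g x y * e x y\<bar>
           \<le> 2 * (1 + log 2 (real (m1 * m2))) ^ 3 * Z * sqrt (\<Sum>x<m1. \<Sum>y<m2. (g x y)\<^sup>2)"
proof -
  define G where "G = sqrt (\<Sum>x<m1. \<Sum>y<m2. (g x y)\<^sup>2)"
  define L where "L = 1 + log 2 (real (m1 * m2))"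
  have Z: "0 \<le> Z" using e unfolding rect_bounded_def by blast
  have G: "0 \<le> G" unfolding G_def by (simp add: sum_nonneg)
  obtain A where A: "m1 \<le> 2 ^ A - 1" "1 \<le> A" "real A \<le> 1 + log 2 (real m1)"
    using dyadic_exponent[OF m(1)] .
  obtain B where B: "m2 \<le> 2 ^ B - 1" "1 \<le> B" "real B \<le> 1 + log 2 (real m2)"
    using dyadic_exponent[OF m(2)] .
  have "log 2 (real (m1 * m2)) = log 2 (real m1) + log 2 (real m2)"
    using m by (simp add: log_mult)
  moreover have "0 \<le> log 2 (real m1)" "0 \<le> log 2 (real m2)" using m by simp_all
  ultimately have AL: "real A \<le> L" and BL: "real B \<le> L" and L: "0 \<le> L"
    using A(3) B(3) unfolding L_def by linarith+
  define S where "S a b = (\<Sum>i<2 ^ a. \<Sum>j<2 ^ b. g (2 ^ a - 1 + i) (2 ^ b - 1 + j) * e (2 ^ a - 1 + i) (2 ^ b - 1 + j))" for a b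
  have gz: "g x y = 0" if "m1 \<le> x \<or> m2 \<le> y" for x y using supp that by (meson linorder_not_less)
  have "(\<Sum>x<m1. \<Sum>y<m2. g x y * e x y) = (\<Sum>x<2 ^ A - 1. \<Sum>y<m2. g x y * e x y)"
    by (rule sum.mono_neutral_left) (use A(1) gz in auto)
  also have "\<dots> = (\<Sum>x<2 ^ A - 1. \<Sum>y<2 ^ B - 1. g x y * e x y)"
    by (rule sum.cong[OF refl], rule sum.mono_neutral_left) (use B(1) gz in auto)
  also have "\<dots> = (\<Sum>a<A. \<Sum>b<B. S a b)"
    unfolding sum_dyadic_shells S_def by (rule sum.cong[OF refl], rule sum.swap)
  also have "\<bar>\<dots>\<bar> \<le> (\<Sum>a<A. \<Sum>b<B. \<bar>S a b\<bar>)"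
    by (intro order_trans[OF sum_abs] sum_mono sum_abs)
  also have "\<dots> \<le> (\<Sum>a<A. \<Sum>b<B. 2 * L * (Z * G))"
  proof (intro sum_mono)
    fix a b assume "a \<in> {..<A}" "b \<in> {..<B}"
    then have ab: "real a + 1 \<le> L" "real b + 1 \<le> L" using AL BL by auto
    have g': "antitone2 (\<lambda>x y. g (2 ^ a - 1 + x) (2 ^ b - 1 + y))"
      using g unfolding antitone2_def by (meson add_left_mono)
    have "\<bar>S a b\<bar> \<le> (2 * real (max a b) + 1) *
        (g (2 ^ a - 1 + 0) (2 ^ b - 1 + 0) * Z * sqrt (2 ^ (a + b)))"
      unfolding S_def by (rule block_bound[OF rect_bounded_shift[OF e] g' nonneg])
    also have "\<dots> = (2 * real (max a b) + 1) * (Z * (g (2 ^ a - 1) (2 ^ b - 1) * sqrt (2 ^ (a + b))))"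
      by (simp only: mult_ac add_0_right)
    also have "\<dots> \<le> (2 * L) * (Z * G)"
      using ab antitone_corner_le[OF g nonneg supp, of a b] nonneg[of "2 ^ a - 1" "2 ^ b - 1"] Z
      unfolding G_def[symmetric]
      by (intro mult_mono) (auto simp: max_def)
    finally show "\<bar>S a b\<bar> \<le> 2 * L * (Z * G)" .
  qed
  also have "\<dots> = real A * real B * (2 * L * (Z * G))" by simp
  also have "\<dots> \<le> L * L * (2 * L * (Z * G))"
    using AL BL L Z G by (intro mult_mono mult_nonneg_nonneg) auto
  also have "\<dots> = 2 * L ^ 3 * Z * G" by (simp add: power3_eq_cube)
  finally show ?thesis unfolding G_def L_def .
qed

text \<open>
  The same condition as \<open>rect_bounded\<close>, but only for the nonempty rectangles inside the grid; these are
  the finitely many sums that are controlled with probability theory.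
\<close>

definition grid_bounded :: "nat \<Rightarrow> nat \<Rightarrow> (nat \<Rightarrow> nat \<Rightarrow> real) \<Rightarrow> real \<Rightarrow> bool" where
  "grid_bounded m1 m2 e Z \<longleftrightarrow> Z \<ge> 0 \<and> (\<forall>x0 x1 y0 y1. x0 < x1 \<longrightarrow> x1 \<le> m1 \<longrightarrow> y0 < y1 \<longrightarrow> y1 \<le> m2 \<longrightarrow>
     \<bar>rect_sum e x0 x1 y0 y1\<bar> \<le> Z * sqrt (real (x1 - x0) * real (y1 - y0)))"

text \<open>
  A rectangle meets the grid in a smaller rectangle.
\<close>

lemma rect_bounded_zero_extension:
  assumes "grid_bounded m1 m2 e Z"
  shows "rect_bounded (\<lambda>x y. if x < m1 \<and> y < m2 then e x y else 0) Z"
  unfolding rect_bounded_def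
proof (intro conjI allI)
  show Z: "0 \<le> Z" using assms unfolding grid_bounded_def by blast
  fix x0 w y0 h
  define x1 y1 where "x1 = min (x0 + w) m1" and "y1 = min (y0 + h) m2"
  have "rect_sum (\<lambda>x y. if x < m1 \<and> y < m2 then e x y else 0) x0 (x0 + w) y0 (y0 + h)
      = (\<Sum>p\<in>{x0..<x0 + w} \<times> {y0..<y0 + h}. if fst p < m1 \<and> snd p < m2 then e (fst p) (snd p) else 0)"
    unfolding rect_sum_def sum.cartesian_product by (rule sum.cong) auto
  also have "\<dots> = (\<Sum>p\<in>{x0..<x1} \<times> {y0..<y1}. e (fst p) (snd p))"
    by (rule sum.mono_neutral_cong_right) (auto simp: x1_def y1_def)
  also have "\<dots> = rect_sum e x0 x1 y0 y1"
    unfolding rect_sum_def sum.cartesian_product by (rule sum.cong) auto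
  finally have eq: "rect_sum (\<lambda>x y. if x < m1 \<and> y < m2 then e x y else 0) x0 (x0 + w) y0 (y0 + h)
      = rect_sum e x0 x1 y0 y1" .
  show "\<bar>rect_sum (\<lambda>x y. if x < m1 \<and> y < m2 then e x y else 0) x0 (x0 + w) y0 (y0 + h)\<bar>
      \<le> Z * sqrt (real w * real h)"
  proof (cases "x0 < x1 \<and> y0 < y1")
    case True
    then have "\<bar>rect_sum e x0 x1 y0 y1\<bar> \<le> Z * sqrt (real (x1 - x0) * real (y1 - y0))"
      using assms unfolding grid_bounded_def x1_def y1_def by simp
    also have "\<dots> \<le> Z * sqrt (real w * real h)"
      using Z by (intro mult_left_mono real_sqrt_le_mono mult_mono) (auto simp: x1_def y1_def)
    finally show ?thesis unfolding eq .
  next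
    case False
    then have "rect_sum e x0 x1 y0 y1 = 0" unfolding rect_sum_def by auto
    then show ?thesis unfolding eq using Z by simp
  qed
qed

lemma grid_bounded_reverse:
  assumes "grid_bounded m1 m2 e Z"
  shows "grid_bounded m1 m2 (\<lambda>x y. e (m1 - Suc x) (m2 - Suc y)) Z"
proof -
  have rev: "(\<Sum>x=a..<b. F (m - Suc x)) = (\<Sum>x=m - b..<m - a. F x)" if "b \<le> m"
    for F :: "nat \<Rightarrow> real" and a b m
    by (rule sum.reindex_bij_witness[where i = "\<lambda>x. m - Suc x" and j = "\<lambda>x. m - Suc x"])
      (use that in auto)
  have "rect_sum (\<lambda>x y. e (m1 - Suc x) (m2 - Suc y)) x0 x1 y0 y1
      = rect_sum e (m1 - x1) (m1 - x0) (m2 - y1) (m2 - y0)"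
    if "x1 \<le> m1" "y1 \<le> m2" for x0 x1 y0 y1
    unfolding rect_sum_def rev[OF that(2)]
    by (rule rev[OF that(1), of "\<lambda>x. \<Sum>y=m2 - y1..<m2 - y0. e x y"])
  moreover have "\<bar>rect_sum e (m1 - x1) (m1 - x0) (m2 - y1) (m2 - y0)\<bar> \<le> Z * sqrt (real (x1 - x0) * real (y1 - y0))"
    if "x0 < x1" "x1 \<le> m1" "y0 < y1" "y1 \<le> m2" for x0 x1 y0 y1
  proof -
    have "m1 - x1 < m1 - x0" "m1 - x0 \<le> m1" "m2 - y1 < m2 - y0" "m2 - y0 \<le> m2"
      and *: "m1 - x0 - (m1 - x1) = x1 - x0" "m2 - y0 - (m2 - y1) = y1 - y0"
      using that by auto
    then show ?thesis using assms unfolding grid_bounded_def by (metis *)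
  qed
  ultimately show ?thesis using assms unfolding grid_bounded_def by simp
qed

text \<open>
  The negative part of an isotone function is antitone; the positive part becomes antitone after
  a reflection of the grid, which permutes the rectangles. Neither has a larger norm than \<open>h\<close>.
\<close>

lemma isotone_sum_bound:
  assumes e: "grid_bounded m1 m2 e Z" and m: "1 \<le> m1" "1 \<le> m2"
    and h: "\<And>x x' y y'. x \<le> x' \<Longrightarrow> x' < m1 \<Longrightarrow> y \<le> y' \<Longrightarrow> y' < m2 \<Longrightarrow> h x y \<le> h x' y'"
  shows "\<bar>\<Sum>x<m1. \<Sum>y<m2. h x y * e x y\<bar>
           \<le> 4 * (1 + log 2 (real (m1 * m2))) ^ 3 * Z * sqrt (\<Sum>x<m1. \<Sum>y<m2. (h x y)\<^sup>2)"
proof -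
  define H where "H = sqrt (\<Sum>x<m1. \<Sum>y<m2. (h x y)\<^sup>2)"
  define L where "L = 1 + log 2 (real (m1 * m2))"
  have Z: "0 \<le> Z" using e unfolding grid_bounded_def by blast
  have "1 \<le> m1 * m2" using m by (metis mult_le_mono nat_mult_1)
  then have "1 \<le> real (m1 * m2)" by (metis of_nat_1 of_nat_mono)
  then have L: "0 \<le> L" unfolding L_def by (intro add_nonneg_nonneg zero_le_log_cancel_iff[THEN iffD2]) simp_all
  have part: "\<bar>\<Sum>x<m1. \<Sum>y<m2. k x y * f x y\<bar> \<le> 2 * L ^ 3 * Z * H"
    if f: "grid_bounded m1 m2 f Z" and k0: "\<And>x y. 0 \<le> k x y"
      and k: "\<And>x x' y y'. x \<le> x' \<Longrightarrow> x' < m1 \<Longrightarrow> y \<le> y' \<Longrightarrow> y' < m2 \<Longrightarrow> k x' y' \<le> k x y"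
      and kH: "(\<Sum>x<m1. \<Sum>y<m2. (k x y)\<^sup>2) \<le> (\<Sum>x<m1. \<Sum>y<m2. (h x y)\<^sup>2)"
    for f k :: "nat \<Rightarrow> nat \<Rightarrow> real"
  proof -
    define g where "g x y = (if x < m1 \<and> y < m2 then k x y else 0)" for x y
    define f' where "f' x y = (if x < m1 \<and> y < m2 then f x y else 0)" for x y
    have f': "rect_bounded f' Z" using rect_bounded_zero_extension[OF f] unfolding f'_def .
    have g: "antitone2 g" unfolding antitone2_def g_def using k k0 by auto
    have g0: "0 \<le> g x y" for x y unfolding g_def using k0 by simp
    have supp: "g x y \<noteq> 0 \<Longrightarrow> x < m1 \<and> y < m2" for x y unfolding g_def by presburger
    have "(\<Sum>x<m1. \<Sum>y<m2. k x y * f x y) = (\<Sum>x<m1. \<Sum>y<m2. g x y * f' x y)"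
      unfolding g_def f'_def by simp
    also have "\<bar>\<dots>\<bar> \<le> 2 * L ^ 3 * Z * sqrt (\<Sum>x<m1. \<Sum>y<m2. (g x y)\<^sup>2)"
      unfolding L_def by (rule antitone_sum_bound[OF f' g g0 supp m])
    also have "(\<Sum>x<m1. \<Sum>y<m2. (g x y)\<^sup>2) = (\<Sum>x<m1. \<Sum>y<m2. (k x y)\<^sup>2)"
      unfolding g_def by simp
    also have "2 * L ^ 3 * Z * sqrt \<dots> \<le> 2 * L ^ 3 * Z * H"
      unfolding H_def using kH Z L by (intro mult_left_mono real_sqrt_le_mono) auto
    finally show ?thesis .
  qed
  define u where "u x y = max 0 (h (m1 - Suc x) (m2 - Suc y))" for x y
  define v where "v x y = max 0 (- h x y)" for x y
  have rev: "(\<Sum>x<m1. \<Sum>y<m2. F (m1 - Suc x) (m2 - Suc y)) = (\<Sum>x<m1. \<Sum>y<m2. F x y)"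
    for F :: "nat \<Rightarrow> nat \<Rightarrow> real"
    by (simp only: sum.nat_diff_reindex[where n = m2] sum.nat_diff_reindex[where n = m1 and g = "\<lambda>x. \<Sum>y<m2. F x y"])
  have "\<bar>\<Sum>x<m1. \<Sum>y<m2. u x y * e (m1 - Suc x) (m2 - Suc y)\<bar> \<le> 2 * L ^ 3 * Z * H"
  proof (rule part[OF grid_bounded_reverse[OF e]])
    show "u x' y' \<le> u x y" if "x \<le> x'" "x' < m1" "y \<le> y'" "y' < m2" for x x' y y'
      using h[of "m1 - Suc x'" "m1 - Suc x" "m2 - Suc y'" "m2 - Suc y"] that
      unfolding u_def by (simp add: max.coboundedI2)
    have "(\<Sum>x<m1. \<Sum>y<m2. (u x y)\<^sup>2) = (\<Sum>x<m1. \<Sum>y<m2. (max 0 (h x y))\<^sup>2)"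
      unfolding u_def by (rule rev[of "\<lambda>x y. (max 0 (h x y))\<^sup>2"])
    also have "\<dots> \<le> (\<Sum>x<m1. \<Sum>y<m2. (h x y)\<^sup>2)"
      by (intro sum_mono) (simp add: max_def)
    finally show "(\<Sum>x<m1. \<Sum>y<m2. (u x y)\<^sup>2) \<le> (\<Sum>x<m1. \<Sum>y<m2. (h x y)\<^sup>2)" .
  qed (simp add: u_def)
  moreover have "\<bar>\<Sum>x<m1. \<Sum>y<m2. v x y * e x y\<bar> \<le> 2 * L ^ 3 * Z * H"
  proof (rule part[OF e])
    show "v x' y' \<le> v x y" if "x \<le> x'" "x' < m1" "y \<le> y'" "y' < m2" for x x' y y'
      using h[OF that] unfolding v_def by (simp add: max.coboundedI2)
    show "(\<Sum>x<m1. \<Sum>y<m2. (v x y)\<^sup>2) \<le> (\<Sum>x<m1. \<Sum>y<m2. (h x y)\<^sup>2)"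
      unfolding v_def by (intro sum_mono) (simp add: max_def)
  qed (simp add: v_def)
  moreover have "(\<Sum>x<m1. \<Sum>y<m2. h x y * e x y)
      = (\<Sum>x<m1. \<Sum>y<m2. u x y * e (m1 - Suc x) (m2 - Suc y)) - (\<Sum>x<m1. \<Sum>y<m2. v x y * e x y)"
  proof -
    have "(\<Sum>x<m1. \<Sum>y<m2. u x y * e (m1 - Suc x) (m2 - Suc y)) = (\<Sum>x<m1. \<Sum>y<m2. max 0 (h x y) * e x y)"
      unfolding u_def by (rule rev[of "\<lambda>x y. max 0 (h x y) * e x y"])
    moreover have "h x y * e x y = max 0 (h x y) * e x y - v x y * e x y" for x y
      unfolding v_def max_def by simp
    ultimately show ?thesis by (simp add: sum_subtractf)
  qed
  ultimately have "\<bar>\<Sum>x<m1. \<Sum>y<m2. h x y * e x y\<bar> \<le> 4 * L ^ 3 * Z * H" by linarith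
  then show ?thesis unfolding H_def L_def .
qed

section \<open>Sums of independent standard normal variables\<close>

abbreviation std_normal_measure :: "real measure" where
  "std_normal_measure \<equiv> density lborel (\<lambda>x. ennreal (std_normal_density x))"

abbreviation iid_normal :: "'a set \<Rightarrow> ('a \<Rightarrow> real) measure" where
  "iid_normal W \<equiv> PiM W (\<lambda>_. std_normal_measure)"

lemma prob_space_std_normal: "prob_space std_normal_measure"
  by (rule prob_space_normal_density) simp

lemma prob_space_iid_normal: "prob_space (iid_normal W)"
  by (intro prob_space_PiM prob_space_std_normal)

lemma measurable_coordinate:
  assumes "w \<in> W" shows "(\<lambda>\<epsilon>. \<epsilon> w) \<in> borel_measurable (iid_normal W)"
proof -
  have "(\<lambda>\<epsilon>. \<epsilon> w) \<in> measurable (iid_normal W) std_normal_measure"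
    by (rule measurable_component_singleton[OF assms])
  also have "measurable (iid_normal W) std_normal_measure = borel_measurable (iid_normal W)"
    by (rule measurable_cong_sets) auto
  finally show ?thesis .
qed

lemma distr_coordinate:
  assumes "w \<in> W"
  shows "distr (iid_normal W) borel (\<lambda>\<epsilon>. \<epsilon> w) = std_normal_measure"
proof -
  have "distr (iid_normal W) borel (\<lambda>\<epsilon>. \<epsilon> w) = distr (iid_normal W) std_normal_measure (\<lambda>\<epsilon>. \<epsilon> w)"
    by (rule distr_cong) auto
  also have "\<dots> = std_normal_measure"
    by (rule distr_PiM_component[OF prob_space_std_normal assms])
  finally show ?thesis .
qed

text \<open>
  The restriction of the coordinate map to the index set is the identity on the product space, so
  the joint law is the product of the marginals by construction.
\<close>

lemma indep_vars_coordinates: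
  assumes "R \<subseteq> W" "R \<noteq> {}"
  shows "prob_space.indep_vars (iid_normal W) (\<lambda>_. borel) (\<lambda>w \<epsilon>. \<epsilon> w) R"
proof -
  interpret prob_space "iid_normal W" by (rule prob_space_iid_normal)
  have W: "W \<noteq> {}" using assms by auto
  have "distr (iid_normal W) (PiM W (\<lambda>_. borel)) (\<lambda>\<epsilon>. \<lambda>w\<in>W. \<epsilon> w) = distr (iid_normal W) (iid_normal W) (\<lambda>\<epsilon>. \<epsilon>)"
    by (rule distr_cong) (auto intro!: sets_PiM_cong simp: space_PiM PiE_restrict)
  also have "\<dots> = PiM W (\<lambda>w. distr (iid_normal W) borel (\<lambda>\<epsilon>. \<epsilon> w))"
    unfolding distr_id by (rule PiM_cong) (simp_all add: distr_coordinate)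
  moreover have "indep_vars (\<lambda>_. borel) (\<lambda>w \<epsilon>. \<epsilon> w) W
      \<longleftrightarrow> distr (iid_normal W) (PiM W (\<lambda>_. borel)) (\<lambda>\<epsilon>. \<lambda>w\<in>W. \<epsilon> w)
            = PiM W (\<lambda>w. distr (iid_normal W) borel (\<lambda>\<epsilon>. \<epsilon> w))"
    by (rule indep_vars_iff_distr_eq_PiM'[OF W measurable_coordinate])
  ultimately have "indep_vars (\<lambda>_. borel) (\<lambda>w \<epsilon>. \<epsilon> w) W" by (simp only:)
  then show ?thesis by (rule indep_vars_subset[OF _ assms(1)])
qed

lemma distributed_sum_coordinates:
  assumes "R \<subseteq> W" "finite R" "R \<noteq> {}"
  shows "distributed (iid_normal W) lborel (\<lambda>\<epsilon>. \<Sum>w\<in>R. \<epsilon> w) (normal_density 0 (sqrt (card R)))"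
proof -
  interpret prob_space "iid_normal W" by (rule prob_space_iid_normal)
  have "distributed (iid_normal W) lborel (\<lambda>\<epsilon>. \<epsilon> w) std_normal_density" if "w \<in> W" for w
    unfolding distributed_def using distr_coordinate[OF that] measurable_coordinate[OF that]
    by (auto cong: distr_cong)
  then have "distributed (iid_normal W) lborel (\<lambda>\<epsilon>. \<Sum>w\<in>R. \<epsilon> w)
      (normal_density (\<Sum>w\<in>R. 0) (sqrt (\<Sum>w\<in>R. 1\<^sup>2)))"
    using assms by (intro sum_indep_normal indep_vars_coordinates) auto
  then show ?thesis by simp
qed

text \<open>
  Multiplication by the exponential doubles the variance and leaves the factor \<open>sqrt 2\<close>.
\<close>

lemma normal_exp_square:
  fixes \<sigma> x :: real
  assumes "0 < \<sigma>"
  shows "normal_density 0 \<sigma> x * exp (x\<^sup>2 / (4 * \<sigma>\<^sup>2)) = sqrt 2 * normal_density 0 (sqrt 2 * \<sigma>) x"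
proof -
  have "- x\<^sup>2 / (2 * \<sigma>\<^sup>2) + x\<^sup>2 / (4 * \<sigma>\<^sup>2) = - x\<^sup>2 / (4 * \<sigma>\<^sup>2)"
    by simp
  then have 1: "exp (- x\<^sup>2 / (2 * \<sigma>\<^sup>2)) * exp (x\<^sup>2 / (4 * \<sigma>\<^sup>2)) = exp (- x\<^sup>2 / (4 * \<sigma>\<^sup>2))"
    by (simp only: exp_add[symmetric])
  have 2: "(sqrt 2 * \<sigma>)\<^sup>2 = 2 * \<sigma>\<^sup>2" by (simp add: power_mult_distrib)
  have "sqrt (2 * pi * (2 * \<sigma>\<^sup>2)) = sqrt 2 * sqrt (2 * pi * \<sigma>\<^sup>2)"
    unfolding real_sqrt_mult[symmetric] by (simp add: mult_ac)
  then have 3: "sqrt 2 * (1 / sqrt (2 * pi * (2 * \<sigma>\<^sup>2))) = 1 / sqrt (2 * pi * \<sigma>\<^sup>2)" by simp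
  have "normal_density 0 \<sigma> x * exp (x\<^sup>2 / (4 * \<sigma>\<^sup>2)) = 1 / sqrt (2 * pi * \<sigma>\<^sup>2) * exp (- x\<^sup>2 / (4 * \<sigma>\<^sup>2))"
    unfolding normal_density_def 1[symmetric] diff_0_right by (simp only: mult.assoc)
  also have "\<dots> = sqrt 2 * normal_density 0 (sqrt 2 * \<sigma>) x"
    unfolding normal_density_def 2 3[symmetric] diff_0_right by (simp only: mult.assoc) simp
  finally show ?thesis .
qed

lemma expectation_exp_square_sum:
  assumes "R \<subseteq> W" "finite R" "R \<noteq> {}"
  shows "integrable (iid_normal W) (\<lambda>\<epsilon>. exp ((\<Sum>w\<in>R. \<epsilon> w)\<^sup>2 / (4 * real (card R))))" (is ?I)
    and "(LINT \<epsilon>|iid_normal W. exp ((\<Sum>w\<in>R. \<epsilon> w)\<^sup>2 / (4 * real (card R)))) = sqrt 2" (is ?E)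
proof -
  define \<sigma> where "\<sigma> = sqrt (real (card R))"
  have pos: "0 < \<sigma>" and sq: "\<sigma>\<^sup>2 = real (card R)" unfolding \<sigma>_def using assms by (auto simp: card_gt_0_iff)
  define f where "f x = exp (x\<^sup>2 / (4 * \<sigma>\<^sup>2))" for x :: real
  have f[measurable]: "f \<in> borel_measurable lborel" unfolding f_def by measurable
  have D: "distributed (iid_normal W) lborel (\<lambda>\<epsilon>. \<Sum>w\<in>R. \<epsilon> w) (normal_density 0 \<sigma>)"
    unfolding \<sigma>_def by (rule distributed_sum_coordinates[OF assms])
  have eq: "(\<lambda>x. normal_density 0 \<sigma> x * f x) = (\<lambda>x. sqrt 2 * normal_density 0 (sqrt 2 * \<sigma>) x)"
    unfolding f_def using normal_exp_square[OF pos] by (rule ext)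
  have s2: "0 < sqrt 2 * \<sigma>" using pos by simp
  have "integrable lborel (\<lambda>x. normal_density 0 \<sigma> x * f x)"
    unfolding eq using integrable_normal_density[OF s2] by simp
  then have "integrable (iid_normal W) (\<lambda>\<epsilon>. f (\<Sum>w\<in>R. \<epsilon> w))"
    using distributed_integrable[OF D f] by simp
  then show ?I unfolding f_def sq .
  have "(LINT \<epsilon>|iid_normal W. f (\<Sum>w\<in>R. \<epsilon> w)) = (LINT x|lborel. normal_density 0 \<sigma> x * f x)"
    using distributed_integral[OF D f] by simp
  also have "\<dots> = sqrt 2" unfolding eq using integral_normal_density[OF s2] by simp
  finally show ?E unfolding f_def sq .
qed

section \<open>Isotone functions and white noise on a grid\<close>

text \<open>
  A linearised form of a maximal inequality: for \<open>N\<close> variables with bounded exponential moments,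
  replacing the exponential by the sum of all \<open>N\<close> exponentials yields a common upper bound with
  expectation \<open>ln N + O(1)\<close>.
\<close>

lemma le_ln_plus_exp:
  fixes N z :: real
  assumes "0 < N"
  shows "z \<le> ln N + exp z / N"
proof -
  have "z - ln N \<le> exp (z - ln N)" using exp_ge_add_one_self[of "z - ln N"] by linarith
  also have "\<dots> = exp z / N" using assms by (simp add: exp_diff)
  finally show ?thesis by linarith
qed

lemma two_mult_minus_square_le:
  fixes X B H :: real
  assumes "\<bar>X\<bar> \<le> B * H"
  shows "2 * X - H\<^sup>2 \<le> B\<^sup>2"
proof -
  have "0 \<le> (B - H)\<^sup>2" by simp
  then have "2 * (B * H) \<le> B\<^sup>2 + H\<^sup>2" by (simp add: power2_diff)
  then show ?thesis using assms by linarith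
qed

text \<open>
  The function \<open>Q\<close> dominates the squares of all normalised rectangle sums of a grid. A grid with \<open>M\<close>
  points has at most \<open>M^2\<close> rectangles, so by \<open>le_ln_plus_exp\<close> with \<open>N = M^2\<close> the logarithm
  of the number of rectangles is at most \<open>2 ln M\<close>. An explicit formula for \<open>Q\<close>, in place of the
  maximum, makes the expectation immediate.
\<close>

lemma grid_noise_envelope:
  fixes \<phi> :: "nat \<Rightarrow> nat \<Rightarrow> 'a"
  assumes m: "1 \<le> m1" "1 \<le> m2" and bij: "bij_betw (\<lambda>(x, y). \<phi> x y) ({..<m1} \<times> {..<m2}) A"
    and A: "A \<subseteq> W"
  obtains Q :: "('a \<Rightarrow> real) \<Rightarrow> real"
  where "integrable (iid_normal W) Q"
    "(LINT \<epsilon>|iid_normal W. Q \<epsilon>) \<le> 8 * (1 + ln (real (card A)))"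
    "\<And>\<epsilon>. 0 \<le> Q \<epsilon>" "\<And>\<epsilon>. grid_bounded m1 m2 (\<lambda>x y. \<epsilon> (\<phi> x y)) (sqrt (Q \<epsilon>))"
proof -
  define R where "R = (\<lambda>(x0, x1, y0, y1). (\<lambda>(x, y). \<phi> x y) ` ({x0..<x1} \<times> {y0..<y1}))"
  define Idx where "Idx = {(x0, x1, y0, y1). x0 < x1 \<and> x1 \<le> m1 \<and> y0 < y1 \<and> y1 \<le> m2}"
  define M where "M = real (m1 * m2)"
  define N where "N = M ^ 2"
  define G where "G r \<epsilon> = exp ((\<Sum>w\<in>R r. \<epsilon> w)\<^sup>2 / (4 * real (card (R r))))" for r and \<epsilon> :: "'a \<Rightarrow> real"
  define Q where "Q \<epsilon> = 4 * (ln N + (\<Sum>r\<in>Idx. G r \<epsilon>) / N)" for \<epsilon>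
  have cA: "card A = m1 * m2" using bij_betw_same_card[OF bij] by (simp add: card_cartesian_product)
  have "1 \<le> m1 * m2" using m by (metis mult_le_mono nat_mult_1)
  then have m1: "1 \<le> M" unfolding M_def by (metis of_nat_1 of_nat_mono)
  then have N: "1 \<le> N" unfolding N_def by (rule one_le_power)
  have sub: "Idx \<subseteq> {..<m1} \<times> {1..m1} \<times> {..<m2} \<times> {1..m2}" unfolding Idx_def by auto
  then have fin: "finite Idx" by (rule finite_subset) auto
  have "card Idx \<le> card ({..<m1} \<times> {1..m1} \<times> {..<m2} \<times> {1..m2})"
    by (rule card_mono[OF _ sub]) auto
  also have "\<dots> = (m1 * m2) ^ 2" by (simp add: card_cartesian_product power2_eq_square)
  finally have "real (card Idx) \<le> real ((m1 * m2) ^ 2)" by (simp only: of_nat_le_iff)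
  then have cI: "real (card Idx) \<le> N" unfolding N_def M_def by (simp only: of_nat_power)
  have inj: "inj_on (\<lambda>(x, y). \<phi> x y) ({..<m1} \<times> {..<m2})" using bij by (rule bij_betw_imp_inj_on)
  have rect: "R r \<subseteq> W \<and> finite (R r) \<and> R r \<noteq> {}
      \<and> real (card (R r)) = real (x1 - x0) * real (y1 - y0)
      \<and> (\<forall>\<epsilon>. (\<Sum>w\<in>R r. \<epsilon> w) = rect_sum (\<lambda>x y. \<epsilon> (\<phi> x y)) x0 x1 y0 y1)"
    if r: "r \<in> Idx" "r = (x0, x1, y0, y1)" for r x0 x1 y0 y1
  proof -
    have s: "{x0..<x1} \<times> {y0..<y1} \<subseteq> {..<m1} \<times> {..<m2}" using r unfolding Idx_def by auto
    have i: "inj_on (\<lambda>(x, y). \<phi> x y) ({x0..<x1} \<times> {y0..<y1})" by (rule inj_on_subset[OF inj s])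
    have Req: "R r = (\<lambda>(x, y). \<phi> x y) ` ({x0..<x1} \<times> {y0..<y1})" unfolding R_def r(2) by simp
    have "R r \<subseteq> A" unfolding Req using s bij_betw_imp_surj_on[OF bij] by blast
    moreover have "R r \<noteq> {}" unfolding Req using r unfolding Idx_def by auto
    moreover have "card (R r) = (x1 - x0) * (y1 - y0)"
      unfolding Req card_image[OF i] by (simp add: card_cartesian_product)
    moreover have "(\<Sum>w\<in>R r. \<epsilon> w) = rect_sum (\<lambda>x y. \<epsilon> (\<phi> x y)) x0 x1 y0 y1" for \<epsilon> :: "'a \<Rightarrow> real"
      unfolding Req sum.reindex[OF i] rect_sum_def sum.cartesian_product by (rule sum.cong) auto
    ultimately show ?thesis using A unfolding Req by (auto simp only: of_nat_mult finite_imageI finite_cartesian_product finite_atLeastLessThan)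
  qed
  have G: "integrable (iid_normal W) (G r)" "(LINT \<epsilon>|iid_normal W. G r \<epsilon>) = sqrt 2" if "r \<in> Idx" for r
    using expectation_exp_square_sum[of "R r" W] rect[OF that] unfolding G_def
    by (metis prod_cases4)+
  have Gs: "integrable (iid_normal W) (\<lambda>\<epsilon>. \<Sum>r\<in>Idx. G r \<epsilon>)"
    by (intro Bochner_Integration.integrable_sum G(1))
  interpret prob_space "iid_normal W" by (rule prob_space_iid_normal)
  have iQ: "integrable (iid_normal W) Q"
    unfolding Q_def using Gs by (intro integrable_mult_right Bochner_Integration.integrable_add integrable_divide) auto
  have "(LINT \<epsilon>|iid_normal W. (\<Sum>r\<in>Idx. G r \<epsilon>)) = (\<Sum>r\<in>Idx. sqrt 2)"
    by (subst Bochner_Integration.integral_sum) (simp_all add: G)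
  then have "(LINT \<epsilon>|iid_normal W. Q \<epsilon>) = 4 * (ln N + real (card Idx) * sqrt 2 / N)"
    unfolding Q_def using Gs by (simp add: prob_space)
  also have "\<dots> \<le> 4 * (2 * ln M + 2)"
  proof -
    have "real (card Idx) * sqrt 2 \<le> N * 2"
      using cI N sqrt2_less_2 by (intro mult_mono) auto
    then have "real (card Idx) * sqrt 2 / N \<le> 2" using N by (simp add: divide_le_eq)
    moreover have "ln N = 2 * ln M" unfolding N_def using m1 by (subst ln_realpow) auto
    ultimately show ?thesis by (intro mult_left_mono add_mono) simp_all
  qed
  finally have EQ: "(LINT \<epsilon>|iid_normal W. Q \<epsilon>) \<le> 8 * (1 + ln (real (card A)))"
    unfolding cA M_def[symmetric] by (simp add: algebra_simps)
  have Gpos: "0 \<le> G r \<epsilon>" for r \<epsilon> unfolding G_def by simp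
  have Qpos: "0 \<le> Q \<epsilon>" for \<epsilon>
    unfolding Q_def using N Gpos by (intro mult_nonneg_nonneg add_nonneg_nonneg divide_nonneg_nonneg sum_nonneg ln_ge_zero) auto
  have "grid_bounded m1 m2 (\<lambda>x y. \<epsilon> (\<phi> x y)) (sqrt (Q \<epsilon>))" for \<epsilon>
    unfolding grid_bounded_def
  proof (intro conjI allI impI)
    show "0 \<le> sqrt (Q \<epsilon>)" using Qpos by simp
    fix x0 x1 y0 y1 assume xy: "x0 < x1" "x1 \<le> m1" "y0 < y1" "y1 \<le> m2"
    define r where "r = (x0, x1, y0, y1)"
    have r: "r \<in> Idx" unfolding r_def Idx_def using xy by simp
    define k where "k = real (x1 - x0) * real (y1 - y0)"
    define s where "s = rect_sum (\<lambda>x y. \<epsilon> (\<phi> x y)) x0 x1 y0 y1"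
    have k: "0 < k" unfolding k_def using xy by simp
    have "s\<^sup>2 / (4 * k) \<le> ln N + exp (s\<^sup>2 / (4 * k)) / N"
      using N by (intro le_ln_plus_exp) simp
    also have "exp (s\<^sup>2 / (4 * k)) = G r \<epsilon>"
      unfolding G_def s_def k_def using rect[OF r r_def] by simp
    also have "ln N + G r \<epsilon> / N \<le> Q \<epsilon> / 4"
    proof -
      have "G r \<epsilon> \<le> (\<Sum>r\<in>Idx. G r \<epsilon>)" using r fin Gpos by (intro member_le_sum) auto
      then have "G r \<epsilon> / N \<le> (\<Sum>r\<in>Idx. G r \<epsilon>) / N" using N by (intro divide_right_mono) auto
      moreover have "Q \<epsilon> / 4 = ln N + (\<Sum>r\<in>Idx. G r \<epsilon>) / N"
        unfolding Q_def by (rule nonzero_mult_div_cancel_left) simp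
      ultimately show ?thesis by (simp only: add_left_mono)
    qed
    finally have "s\<^sup>2 \<le> Q \<epsilon> * k" using k by (simp add: divide_le_eq)
    then have "\<bar>s\<bar> \<le> sqrt (Q \<epsilon> * k)" using real_sqrt_le_mono by fastforce
    then show "\<bar>rect_sum (\<lambda>x y. \<epsilon> (\<phi> x y)) x0 x1 y0 y1\<bar> \<le> sqrt (Q \<epsilon>) * sqrt (real (x1 - x0) * real (y1 - y0))"
      unfolding s_def k_def by (simp only: real_sqrt_mult)
  qed
  with that[OF iQ EQ Qpos] show ?thesis by blast
qed

text \<open>
  Completing the square turns the bound \<open>|<\<epsilon>, h>| \<le> B |h|\<close> of \<open>isotone_sum_bound\<close>, in which \<open>B\<close> depends on
  the noise alone, into \<open>2 <\<epsilon>, h> - |h|^2 \<le> B^2\<close>. Of the seven logarithms, six come from the squared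
  deterministic constant and one from the expectation of the noise envelope.
\<close>

lemma gaussian_width_isotone_grid:
  fixes \<phi> :: "nat \<Rightarrow> nat \<Rightarrow> 'a"
  assumes m: "1 \<le> m1" "1 \<le> m2" and bij: "bij_betw (\<lambda>(x, y). \<phi> x y) ({..<m1} \<times> {..<m2}) A"
    and A: "A \<subseteq> W"
  shows "\<exists>T. integrable (iid_normal W) T
    \<and> (LINT \<epsilon>|iid_normal W. T \<epsilon>) \<le> 8192 * (1 + ln (real (card A))) ^ 7
    \<and> (\<forall>\<epsilon> h. (\<forall>x x' y y'. x \<le> x' \<longrightarrow> x' < m1 \<longrightarrow> y \<le> y' \<longrightarrow> y' < m2 \<longrightarrow> h (\<phi> x y) \<le> h (\<phi> x' y'))
         \<longrightarrow> 2 * (\<Sum>w\<in>A. h w * \<epsilon> w) - (\<Sum>w\<in>A. (h w)\<^sup>2) \<le> T \<epsilon>)"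
proof -
  obtain Q where Q: "integrable (iid_normal W) Q"
    "(LINT \<epsilon>|iid_normal W. Q \<epsilon>) \<le> 8 * (1 + ln (real (card A)))"
    "\<And>\<epsilon>. 0 \<le> Q \<epsilon>" "\<And>\<epsilon>. grid_bounded m1 m2 (\<lambda>x y. \<epsilon> (\<phi> x y)) (sqrt (Q \<epsilon>))"
    using grid_noise_envelope[OF m bij A] by blast
  define L where "L = 1 + log 2 (real (card A))"
  define l where "l = 1 + ln (real (card A))"
  have cA: "card A = m1 * m2" using bij_betw_same_card[OF bij] by (simp add: card_cartesian_product)
  have "1 \<le> m1 * m2" using m by (metis mult_le_mono nat_mult_1)
  then have m1: "1 \<le> real (card A)" unfolding cA by (metis of_nat_1 of_nat_mono)
  have l: "1 \<le> l" unfolding l_def using m1 by simp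
  have L0: "0 \<le> L" unfolding L_def using m1 by simp
  have Ll: "L \<le> 2 * l"
  proof -
    have "1 / 2 \<le> ln (2::real)" using ln2_ge_two_thirds by linarith
    then have "ln (real (card A)) / ln 2 \<le> ln (real (card A)) / (1 / 2)"
      using m1 by (intro divide_left_mono) auto
    then show ?thesis unfolding L_def l_def log_def by simp
  qed
  define T where "T \<epsilon> = (4 * L ^ 3)\<^sup>2 * Q \<epsilon>" for \<epsilon>
  have "integrable (iid_normal W) T" unfolding T_def using Q(1) by simp
  moreover have "(LINT \<epsilon>|iid_normal W. T \<epsilon>) \<le> 8192 * l ^ 7"
  proof -
    have "(LINT \<epsilon>|iid_normal W. T \<epsilon>) = (4 * L ^ 3)\<^sup>2 * (LINT \<epsilon>|iid_normal W. Q \<epsilon>)"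
      unfolding T_def by simp
    also have "\<dots> \<le> (4 * (2 * l) ^ 3)\<^sup>2 * (8 * l)"
      using Q(2) Ll L0 l Q(3) unfolding l_def[symmetric]
      by (intro mult_mono power_mono mult_left_mono Bochner_Integration.integral_nonneg) auto
    also have "\<dots> = 8192 * l ^ 7" by (simp add: power_mult_distrib eval_nat_numeral)
    finally show ?thesis .
  qed
  moreover have "2 * (\<Sum>w\<in>A. h w * \<epsilon> w) - (\<Sum>w\<in>A. (h w)\<^sup>2) \<le> T \<epsilon>"
    if h: "\<And>x x' y y'. x \<le> x' \<Longrightarrow> x' < m1 \<Longrightarrow> y \<le> y' \<Longrightarrow> y' < m2 \<Longrightarrow> h (\<phi> x y) \<le> h (\<phi> x' y')" for \<epsilon> h
  proof -
    have re: "(\<Sum>w\<in>A. F w) = (\<Sum>x<m1. \<Sum>y<m2. F (\<phi> x y))" for F :: "'a \<Rightarrow> real"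
      unfolding sum.reindex_bij_betw[OF bij, symmetric] sum.cartesian_product by (rule sum.cong) auto
    have "\<bar>\<Sum>w\<in>A. h w * \<epsilon> w\<bar> \<le> 4 * L ^ 3 * sqrt (Q \<epsilon>) * sqrt (\<Sum>w\<in>A. (h w)\<^sup>2)"
      unfolding re L_def cA by (rule isotone_sum_bound[OF Q(4) m h])
    then have "2 * (\<Sum>w\<in>A. h w * \<epsilon> w) - (sqrt (\<Sum>w\<in>A. (h w)\<^sup>2))\<^sup>2 \<le> (4 * L ^ 3 * sqrt (Q \<epsilon>))\<^sup>2"
      by (rule two_mult_minus_square_le)
    moreover have "(sqrt (\<Sum>w\<in>A. (h w)\<^sup>2))\<^sup>2 = (\<Sum>w\<in>A. (h w)\<^sup>2)" by (simp add: sum_nonneg)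
    moreover have "(4 * L ^ 3 * sqrt (Q \<epsilon>))\<^sup>2 = T \<epsilon>"
      unfolding T_def using Q(3) by (simp add: power_mult_distrib)
    ultimately show ?thesis by linarith
  qed
  ultimately show ?thesis unfolding l_def by blast
qed

section \<open>Least squares over a closed convex set\<close>

text \<open>
  Points of the product space that are at least as good as a fixed element of \<open>S\<close> have coordinates in bounded
  intervals on \<open>W\<close> and the value \<open>undefined\<close> outside; they lie in a box that is compact by Tychonoff's
  theorem.
\<close>

lemma least_squares_exists:
  fixes S :: "('a \<Rightarrow> real) set"
  assumes W: "finite W" and S: "closed S" "S \<subseteq> extensional W" "S \<noteq> {}"
  shows "\<exists>\<theta>\<in>S. \<forall>\<eta>\<in>S. (\<Sum>w\<in>W. (\<theta> w - y w)\<^sup>2) \<le> (\<Sum>w\<in>W. (\<eta> w - y w)\<^sup>2)"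
proof -
  define q where "q \<theta> = (\<Sum>w\<in>W. (\<theta> w - y w)\<^sup>2)" for \<theta>
  obtain \<theta>1 where \<theta>1: "\<theta>1 \<in> S" using S(3) by auto
  define B where "B = sqrt (q \<theta>1)"
  define I where "I w = (if w \<in> W then {y w - B..y w + B} else {undefined})" for w
  have "compactin (product_topology (\<lambda>_. euclidean) UNIV) (PiE UNIV I)"
    unfolding compactin_PiE by (auto simp: I_def)
  then have "compact (PiE UNIV I)" unfolding euclidean_product_topology by simp
  then have comp: "compact (PiE UNIV I \<inter> S)" using S(1) by (rule compact_Int_closed)
  have inI: "\<eta> \<in> PiE UNIV I" if "\<eta> \<in> S" "q \<eta> \<le> q \<theta>1" for \<eta>
  proof -
    have "\<bar>\<eta> w - y w\<bar> \<le> B" if "w \<in> W" for w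
    proof -
      have "(\<eta> w - y w)\<^sup>2 \<le> q \<eta>" unfolding q_def
        by (rule member_le_sum[OF that _ W, of "\<lambda>w. (\<eta> w - y w)\<^sup>2"]) simp
      then have "(\<eta> w - y w)\<^sup>2 \<le> q \<theta>1" using \<open>q \<eta> \<le> q \<theta>1\<close> by linarith
      then show ?thesis unfolding B_def using real_sqrt_le_mono by fastforce
    qed
    moreover have "\<eta> w = undefined" if "w \<notin> W" for w
      using S(2) \<open>\<eta> \<in> S\<close> that by (auto simp: extensional_def)
    ultimately show ?thesis unfolding I_def by (auto simp: abs_le_iff PiE_iff) (smt (verit))+
  qed
  have "continuous_on (PiE UNIV I \<inter> S) q"
    unfolding q_def by (intro continuous_intros continuous_on_subset[OF continuous_on_product_coordinates]) auto
  moreover have "PiE UNIV I \<inter> S \<noteq> {}" using inI[OF \<theta>1] \<theta>1 by auto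
  ultimately have "\<exists>\<theta>\<in>PiE UNIV I \<inter> S. \<forall>\<eta>\<in>PiE UNIV I \<inter> S. q \<theta> \<le> q \<eta>"
    by (intro continuous_attains_inf comp)
  then obtain \<theta> where \<theta>: "\<theta> \<in> PiE UNIV I \<inter> S" "\<And>\<eta>. \<eta> \<in> PiE UNIV I \<inter> S \<Longrightarrow> q \<theta> \<le> q \<eta>"
    by blast
  have "q \<theta> \<le> q \<eta>" if "\<eta> \<in> S" for \<eta>
  proof (cases "q \<eta> \<le> q \<theta>1")
    case True
    then show ?thesis using \<theta>(2) inI[OF that] that by blast
  next
    case False
    moreover have "q \<theta> \<le> q \<theta>1" using \<theta>(2) inI[OF \<theta>1] \<theta>1 by blast
    ultimately show ?thesis by linarith
  qed
  then show ?thesis using \<theta>(1) unfolding q_def by blast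
qed

text \<open>
  The first-order condition at a minimiser. Let \<open>I\<close> be the inner product and \<open>D\<close> the squared distance
  from \<open>\<theta>\<close> to \<open>\<eta>\<close>. If \<open>I\<close> were negative, moving the fraction \<open>- I / (D - I)\<close> of the way towards \<open>\<eta>\<close>
  would decrease the quadratic objective.
\<close>

lemma least_squares_variational:
  fixes S :: "('a \<Rightarrow> real) set"
  assumes convex: "\<And>\<theta> \<eta> t. \<theta> \<in> S \<Longrightarrow> \<eta> \<in> S \<Longrightarrow> 0 \<le> t \<Longrightarrow> t \<le> 1 \<Longrightarrow>
                   (\<lambda>w\<in>W. \<theta> w + t * (\<eta> w - \<theta> w)) \<in> S"
    and min: "\<theta> \<in> S" "\<And>\<eta>. \<eta> \<in> S \<Longrightarrow> (\<Sum>w\<in>W. (\<theta> w - y w)\<^sup>2) \<le> (\<Sum>w\<in>W. (\<eta> w - y w)\<^sup>2)"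
    and \<eta>: "\<eta> \<in> S"
  shows "0 \<le> (\<Sum>w\<in>W. (\<theta> w - y w) * (\<eta> w - \<theta> w))"
proof (rule ccontr)
  define I where "I = (\<Sum>w\<in>W. (\<theta> w - y w) * (\<eta> w - \<theta> w))"
  define D where "D = (\<Sum>w\<in>W. (\<eta> w - \<theta> w)\<^sup>2)"
  define t where "t = - I / (D - I)"
  assume "\<not> 0 \<le> (\<Sum>w\<in>W. (\<theta> w - y w) * (\<eta> w - \<theta> w))"
  then have I: "I < 0" unfolding I_def by simp
  have D: "0 \<le> D" unfolding D_def by (simp add: sum_nonneg)
  have t: "0 < t" "t \<le> 1" unfolding t_def using I D by (auto simp: divide_simps)
  have "(\<Sum>w\<in>W. (\<theta> w - y w)\<^sup>2) \<le> (\<Sum>w\<in>W. ((\<lambda>w\<in>W. \<theta> w + t * (\<eta> w - \<theta> w)) w - y w)\<^sup>2)"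
    using t by (intro min(2) convex min(1) \<eta>) auto
  also have "\<dots> = (\<Sum>w\<in>W. (\<theta> w - y w)\<^sup>2 + (2 * t * ((\<theta> w - y w) * (\<eta> w - \<theta> w)) + t\<^sup>2 * (\<eta> w - \<theta> w)\<^sup>2))"
    by (rule sum.cong) (auto simp: power2_eq_square algebra_simps)
  also have "\<dots> = (\<Sum>w\<in>W. (\<theta> w - y w)\<^sup>2) + (2 * t * I + t\<^sup>2 * D)"
    unfolding I_def D_def by (simp only: sum.distrib sum_distrib_left[symmetric])
  finally have "0 \<le> t * (2 * I + t * D)" by (simp add: power2_eq_square algebra_simps)
  then have "0 \<le> 2 * I + t * D" using t by (simp add: zero_le_mult_iff)
  moreover have "t * D \<le> - I"
  proof -
    have "t * (D - I) = - I" unfolding t_def using I D by simp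
    moreover have "t * I \<le> 0" using t I by (simp add: mult_nonneg_nonpos)
    ultimately show ?thesis by (simp add: right_diff_distrib)
  qed
  ultimately show False using I by linarith
qed

text \<open>
  The difference of the two sides is twice the inner product in the assumption.
\<close>

lemma least_squares_oracle:
  fixes \<theta> \<theta>0 \<eta> \<epsilon> :: "'a \<Rightarrow> real"
  assumes vi: "0 \<le> (\<Sum>w\<in>W. (\<theta> w - (\<theta>0 w + \<epsilon> w)) * (\<eta> w - \<theta> w))"
  shows "(\<Sum>w\<in>W. (\<theta> w - \<theta>0 w)\<^sup>2) \<le> (\<Sum>w\<in>W. (\<eta> w - \<theta>0 w)\<^sup>2)
            + (2 * (\<Sum>w\<in>W. (\<theta> w - \<eta> w) * \<epsilon> w) - (\<Sum>w\<in>W. (\<theta> w - \<eta> w)\<^sup>2))"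
proof -
  have "(\<Sum>w\<in>W. (\<theta> w - \<theta>0 w)\<^sup>2) = (\<Sum>w\<in>W. (\<eta> w - \<theta>0 w)\<^sup>2 + (2 * ((\<theta> w - \<eta> w) * \<epsilon> w) - (\<theta> w - \<eta> w)\<^sup>2)
      - 2 * ((\<theta> w - (\<theta>0 w + \<epsilon> w)) * (\<eta> w - \<theta> w)))"
    by (rule sum.cong) (simp_all add: power2_eq_square algebra_simps)
  also have "\<dots> = (\<Sum>w\<in>W. (\<eta> w - \<theta>0 w)\<^sup>2)
            + (2 * (\<Sum>w\<in>W. (\<theta> w - \<eta> w) * \<epsilon> w) - (\<Sum>w\<in>W. (\<theta> w - \<eta> w)\<^sup>2))
            - 2 * (\<Sum>w\<in>W. (\<theta> w - (\<theta>0 w + \<epsilon> w)) * (\<eta> w - \<theta> w))"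
    by (simp only: sum.distrib sum_subtractf sum_distrib_left[symmetric])
  finally show ?thesis using vi by linarith
qed

section \<open>Two-dimensional sheets\<close>

lemma finite_lattice_points: "finite (lattice_points d n1)"
  unfolding lattice_points_def by (intro finite_PiE) auto

lemma card_lattice_points: "card (lattice_points d n1) = n1 ^ d"
  unfolding lattice_points_def by (subst card_PiE) simp_all

lemma nat_interval_between_reals:
  fixes a b :: real
  assumes "z \<in> {x \<in> {1..n}. real x \<in> {a..b}}"
  obtains p m where "1 \<le> m" "{x \<in> {1..n}. real x \<in> {a..b}} = {p..<p + m}"
proof -
  define I where "I = {x \<in> {1..n}. real x \<in> {a..b}}"
  have I: "finite I" "I \<noteq> {}" using assms unfolding I_def by auto
  define p q where "p = Min I" and "q = Max I"
  have p: "p \<in> I" and q: "q \<in> I" unfolding p_def q_def using I by auto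
  have pq: "p \<le> q" unfolding p_def q_def using I by simp
  have "I = {p..<p + (q + 1 - p)}"
  proof
    show "I \<subseteq> {p..<p + (q + 1 - p)}"
      using I Min_le[OF I(1)] Max_ge[OF I(1)] pq unfolding p_def[symmetric] q_def[symmetric]
      by (force simp: less_Suc_eq_le)
    show "{p..<p + (q + 1 - p)} \<subseteq> I"
    proof
      fix x assume "x \<in> {p..<p + (q + 1 - p)}"
      then have x: "p \<le> x" "x \<le> q" using pq by auto
      then have "real p \<le> real x" "real x \<le> real q" by auto
      with p q x show "x \<in> I" unfolding I_def by auto
    qed
  qed
  moreover have "1 \<le> q + 1 - p" using pq by simp
  ultimately show ?thesis using that unfolding I_def by blast
qed

text \<open>
  At most two coordinates of a sheet vary. Two distinct coordinates that include these parametrise the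
  sheet; all others are determined by any single point of it.
\<close>

lemma two_dim_sheet_parametrization:
  assumes A: "two_dim_sheet d n1 A" "A \<noteq> {}" and d: "2 \<le> d"
  shows "\<exists>m1 m2. \<exists>\<phi> :: nat \<Rightarrow> nat \<Rightarrow> nat \<Rightarrow> nat. 1 \<le> m1 \<and> 1 \<le> m2
    \<and> bij_betw (\<lambda>(x, y). \<phi> x y) ({..<m1} \<times> {..<m2}) A
    \<and> (\<forall>x x' y y'. x \<le> x' \<longrightarrow> y \<le> y' \<longrightarrow> lattice_le d (\<phi> x y) (\<phi> x' y'))"
proof -
  obtain a b :: "nat \<Rightarrow> real" where
    Aeq: "A = {w \<in> lattice_points d n1. \<forall>j\<in>{1..d}. real (w j) \<in> {a j..b j}}" and
    flat: "card {j \<in> {1..d}. a j = b j} \<ge> d - 2"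
    using A(1) unfolding two_dim_sheet_def by blast
  obtain w0 where w0: "w0 \<in> A" using A(2) by auto
  define J where "J = {j \<in> {1..d}. a j \<noteq> b j}"
  have "card J + card {j \<in> {1..d}. a j = b j} = card (J \<union> {j \<in> {1..d}. a j = b j})"
    by (rule card_Un_disjoint[symmetric]) (auto simp: J_def)
  also have "J \<union> {j \<in> {1..d}. a j = b j} = {1..d}" unfolding J_def by auto
  finally have "card J \<le> 2" using flat by simp
  moreover have "J \<subseteq> {1..d}" unfolding J_def by auto
  ultimately obtain T where T: "J \<subseteq> T" "T \<subseteq> {1..d}" "card T = 2"
    using exists_subset_between[of J 2 "{1..d}"] d by auto
  then obtain i j where ij: "T = {i, j}" "i \<noteq> j" by (auto simp: card_2_iff)
  have i: "i \<in> {1..d}" and j: "j \<in> {1..d}" using T ij by auto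
  \<comment> \<open>The bounds of a sheet are real, but its side is an interval of natural numbers.\<close>
  define I where "I k = {x \<in> {1..n1}. real x \<in> {a k..b k}}" for k
  have mem: "w k \<in> I k" if "w \<in> A" "k \<in> {1..d}" for w k
    using that unfolding Aeq I_def lattice_points_def by auto
  obtain p m1 where p: "1 \<le> m1" "I i = {p..<p + m1}"
    using nat_interval_between_reals[OF mem[OF w0 i, unfolded I_def]] unfolding I_def .
  obtain q m2 where q: "1 \<le> m2" "I j = {q..<q + m2}"
    using nat_interval_between_reals[OF mem[OF w0 j, unfolded I_def]] unfolding I_def .
  define \<phi> where "\<phi> x y = w0(i := p + x, j := q + y)" for x y
  have "bij_betw (\<lambda>(x, y). \<phi> x y) ({..<m1} \<times> {..<m2}) A"
  proof (rule bij_betw_imageI)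
    show "inj_on (\<lambda>(x, y). \<phi> x y) ({..<m1} \<times> {..<m2})"
    proof (rule inj_onI, clarify)
      fix x y x' y' assume "\<phi> x y = \<phi> x' y'"
      then have "\<phi> x y i = \<phi> x' y' i" "\<phi> x y j = \<phi> x' y' j" by simp_all
      then show "x = x' \<and> y = y'" using ij(2) unfolding \<phi>_def by simp
    qed
    show "(\<lambda>(x, y). \<phi> x y) ` ({..<m1} \<times> {..<m2}) = A"
    proof (intro equalityI subsetI)
      fix w assume "w \<in> (\<lambda>(x, y). \<phi> x y) ` ({..<m1} \<times> {..<m2})"
      then obtain x y where xy: "x < m1" "y < m2" and w: "w = \<phi> x y" by auto
      have "p + x \<in> I i" "q + y \<in> I j" using xy p q by auto
      then show "w \<in> A" using w0 i j unfolding w \<phi>_def Aeq I_def lattice_points_def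
        by (auto simp: PiE_iff extensional_def)
    next
      fix w assume w: "w \<in> A"
      have "w k = w0 k" if "k \<noteq> i" "k \<noteq> j" for k
      proof (cases "k \<in> {1..d}")
        case True
        then have "a k = b k" using T(1) ij(1) that unfolding J_def by auto
        then show ?thesis using mem[OF w True] mem[OF w0 True] unfolding I_def by auto
      next
        case False
        then show ?thesis using w w0 unfolding Aeq lattice_points_def by (auto simp: PiE_iff extensional_def)
      qed
      moreover have "w i \<in> {p..<p + m1}" "w j \<in> {q..<q + m2}"
        using mem[OF w i] mem[OF w j] p q by auto
      ultimately have "w = \<phi> (w i - p) (w j - q)" "w i - p < m1" "w j - q < m2"
        unfolding \<phi>_def by (auto simp: fun_eq_iff)
      then show "w \<in> (\<lambda>(x, y). \<phi> x y) ` ({..<m1} \<times> {..<m2})"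
        by (intro rev_image_eqI[of "(w i - p, w j - q)"]) simp_all
    qed
  qed
  moreover have "lattice_le d (\<phi> x y) (\<phi> x' y')" if "x \<le> x'" "y \<le> y'" for x x' y y'
    using that ij(2) unfolding lattice_le_def \<phi>_def by auto
  ultimately show ?thesis using p(1) q(1) by blast
qed

lemma singleton_two_dim_sheet:
  assumes "w \<in> lattice_points d n1"
  shows "two_dim_sheet d n1 {w}"
proof -
  have "{w} = {v \<in> lattice_points d n1. \<forall>j\<in>{1..d}. real (v j) \<in> {real (w j)..real (w j)}}"
    using assms PiE_ext[of _ "{1..d}" "\<lambda>_. {1..n1}" w] unfolding lattice_points_def by auto
  moreover have "card {j \<in> {1..d}. real (w j) = real (w j)} \<ge> d - 2"
    by (simp only: simp_thms Collect_mem_eq card_atLeastAtMost diff_le_self)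
  ultimately show ?thesis unfolding two_dim_sheet_def
    by (intro exI[of _ "\<lambda>j. real (w j)"] conjI)
qed

text \<open>
  The partition into singletons shows that the minimum in \<open>sheet_complexity\<close> is attained.
\<close>

lemma sheet_partition_exists:
  shows "\<exists>P. partition_on (lattice_points d n1) P \<and> finite P \<and> card P = sheet_complexity d n1 \<theta>
     \<and> (\<forall>A\<in>P. two_dim_sheet d n1 A \<and> \<theta> constant_on A)"
  unfolding sheet_complexity_def
proof (rule LeastI_ex, intro exI conjI)
  let ?P = "(\<lambda>w. {w}) ` lattice_points d n1"
  show "card ?P = card ?P" by (rule refl)
  show "partition_on (lattice_points d n1) ?P"
    unfolding partition_on_def disjoint_def by auto
  show "finite ?P" using finite_lattice_points by simp
  show "\<forall>A\<in>?P. two_dim_sheet d n1 A \<and> \<theta> constant_on A"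
    using singleton_two_dim_sheet by (auto simp: constant_on_def)
qed


section \<open>The isotonic least squares estimator\<close>

lemma zero_isotonic: "(\<lambda>w\<in>lattice_points d n1. 0) \<in> isotonic d n1"
  unfolding isotonic_def lattice_vectors_def by auto

lemma closed_isotonic: "closed (isotonic d n1)"
proof -
  let ?W = "lattice_points d n1"
  have "isotonic d n1 = (\<Inter>w\<in>-?W. {\<theta>. \<theta> w = undefined})
      \<inter> (\<Inter>u\<in>?W. \<Inter>v\<in>{v\<in>?W. lattice_le d u v}. {\<theta>. \<theta> u \<le> \<theta> v})"
    unfolding isotonic_def lattice_vectors_def by (auto simp: PiE_iff extensional_def)
  also have "closed \<dots>"
    by (intro closed_Int closed_INT ballI closed_Collect_eq closed_Collect_le continuous_on_product_coordinates continuous_on_const)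
  finally show ?thesis .
qed

lemma isotonic_convex:
  assumes "\<theta> \<in> isotonic d n1" "\<eta> \<in> isotonic d n1" "0 \<le> t" "t \<le> 1"
  shows "(\<lambda>w\<in>lattice_points d n1. \<theta> w + t * (\<eta> w - \<theta> w)) \<in> isotonic d n1"
proof -
  have "\<theta> u + t * (\<eta> u - \<theta> u) \<le> \<theta> v + t * (\<eta> v - \<theta> v)" if "\<theta> u \<le> \<theta> v" "\<eta> u \<le> \<eta> v" for u v
  proof -
    have "(1 - t) * \<theta> u + t * \<eta> u \<le> (1 - t) * \<theta> v + t * \<eta> v"
      using that assms(3,4) by (intro add_mono mult_left_mono) auto
    then show ?thesis by (simp add: algebra_simps)
  qed
  then show ?thesis using assms(1,2) unfolding isotonic_def lattice_vectors_def by auto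
qed

lemma lattice_norm_square: "(lattice_norm d n1 x)\<^sup>2 = (\<Sum>w\<in>lattice_points d n1. (x w)\<^sup>2)"
  unfolding lattice_norm_def L2_set_def by (intro real_sqrt_pow2 sum_nonneg) simp

lemma lattice_norm_le_iff:
  "lattice_norm d n1 x \<le> lattice_norm d n1 z
     \<longleftrightarrow> (\<Sum>w\<in>lattice_points d n1. (x w)\<^sup>2) \<le> (\<Sum>w\<in>lattice_points d n1. (z w)\<^sup>2)"
  unfolding lattice_norm_def L2_set_def by (rule real_sqrt_le_iff)

text \<open>
  The estimator is defined by a definite description, so existence and uniqueness of the minimiser are
  needed first. Two minimisers coincide because the inner products in their two variational
  inequalities add up to minus their squared distance.
\<close>

lemma lse_properties:
  fixes y :: "(nat \<Rightarrow> nat) \<Rightarrow> real"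
  shows "lse d n1 y \<in> isotonic d n1"
    and "\<And>\<eta>. \<eta> \<in> isotonic d n1 \<Longrightarrow>
       0 \<le> (\<Sum>w\<in>lattice_points d n1. (lse d n1 y w - y w) * (\<eta> w - lse d n1 y w))"
proof -
  let ?W = "lattice_points d n1" and ?S = "isotonic d n1"
  define q where "q \<theta> = (\<Sum>w\<in>?W. (\<theta> w - y w)\<^sup>2)" for \<theta>
  have ext: "?S \<subseteq> extensional ?W" unfolding isotonic_def lattice_vectors_def by (auto simp: PiE_def)
  have arg_min: "is_arg_min (\<lambda>\<theta>. lattice_norm d n1 (\<lambda>w. \<theta> w - y w)) (\<lambda>\<theta>. \<theta> \<in> ?S) \<theta>
      \<longleftrightarrow> \<theta> \<in> ?S \<and> (\<forall>\<eta>\<in>?S. q \<theta> \<le> q \<eta>)" for \<theta>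
    unfolding is_arg_min_linorder lattice_norm_le_iff q_def by auto
  have vi: "0 \<le> (\<Sum>w\<in>?W. (\<theta> w - y w) * (\<eta> w - \<theta> w))"
    if "\<theta> \<in> ?S \<and> (\<forall>\<eta>\<in>?S. q \<theta> \<le> q \<eta>)" "\<eta> \<in> ?S" for \<theta> \<eta>
    by (rule least_squares_variational[OF isotonic_convex])
      (use that in \<open>auto simp: q_def\<close>)
  have uniq: "\<theta> = \<theta>'" if \<theta>: "\<theta> \<in> ?S \<and> (\<forall>\<eta>\<in>?S. q \<theta> \<le> q \<eta>)" and \<theta>': "\<theta>' \<in> ?S \<and> (\<forall>\<eta>\<in>?S. q \<theta>' \<le> q \<eta>)" for \<theta> \<theta>'
  proof -
    have "(\<Sum>w\<in>?W. (\<theta> w - \<theta>' w)\<^sup>2) = - ((\<Sum>w\<in>?W. (\<theta> w - y w) * (\<theta>' w - \<theta> w)) + (\<Sum>w\<in>?W. (\<theta>' w - y w) * (\<theta> w - \<theta>' w)))"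
      unfolding sum.distrib[symmetric] sum_negf[symmetric]
      by (rule sum.cong) (simp_all add: power2_eq_square algebra_simps)
    also have "\<dots> \<le> 0" using vi[OF \<theta>, of \<theta>'] vi[OF \<theta>', of \<theta>] \<theta> \<theta>' by linarith
    finally have "(\<Sum>w\<in>?W. (\<theta> w - \<theta>' w)\<^sup>2) = 0" by (intro antisym sum_nonneg) auto
    then have "\<forall>w\<in>?W. (\<theta> w - \<theta>' w)\<^sup>2 = 0"
      by (subst (asm) sum_nonneg_eq_0_iff[OF finite_lattice_points]) auto
    then show "\<theta> = \<theta>'" using \<theta> \<theta>' ext by (intro extensionalityI[of _ ?W]) auto
  qed
  have "\<exists>\<theta>. \<theta> \<in> ?S \<and> (\<forall>\<eta>\<in>?S. q \<theta> \<le> q \<eta>)"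
    using least_squares_exists[OF finite_lattice_points closed_isotonic ext, of y] zero_isotonic
    unfolding q_def by blast
  then obtain \<theta> where \<theta>: "\<theta> \<in> ?S \<and> (\<forall>\<eta>\<in>?S. q \<theta> \<le> q \<eta>)" by blast
  have "lse d n1 y = \<theta>" unfolding lse_def arg_min using \<theta> uniq by (intro the_equality) blast+
  with \<theta> vi show "lse d n1 y \<in> ?S"
    "\<And>\<eta>. \<eta> \<in> ?S \<Longrightarrow> 0 \<le> (\<Sum>w\<in>?W. (lse d n1 y w - y w) * (\<eta> w - lse d n1 y w))" by auto
qed

section \<open>Adding powers of logarithms over a partition\<close>

text \<open>
  A tangent-line substitute for the concavity of the power of a logarithm: the part of \<open>a\<close> that exceeds
  \<open>2 * L\<close> is at most \<open>ln r\<close>, and powers of \<open>ln r\<close> grow more slowly than \<open>r\<close>.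
\<close>

lemma log_power_le_linear:
  fixes r L :: real
  assumes r: "0 < r" and L: "1 \<le> L" and a: "0 \<le> a" "a \<le> 2 * L + ln r"
  shows "a ^ 7 \<le> 2 ^ 15 * L ^ 8 + 2 ^ 31 * r"
proof -
  define u where "u = max 0 (ln r)"
  have u: "0 \<le> u" "ln r \<le> u" unfolding u_def by auto
  have u8: "u ^ 8 \<le> 2 ^ 24 * r"
  proof (cases "1 \<le> r")
    case True
    then have ur: "u = ln r" unfolding u_def by simp
    have "(u / 8) ^ 8 \<le> exp (u / 8) ^ 8"
      using u(1) exp_ge_add_one_self[of "u / 8"] by (intro power_mono) linarith+
    also have "\<dots> = exp (8 * (u / 8))" by (metis exp_of_nat_mult of_nat_numeral)
    also have "\<dots> = r" using r unfolding ur by simp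
    finally show ?thesis by (simp add: power_divide)
  next
    case False
    then have "u = 0" unfolding u_def using r by simp
    then show ?thesis using r by simp
  qed
  have pow: "(x + y) ^ 8 \<le> 2 ^ 7 * (x ^ 8 + y ^ 8)" if "0 \<le> x" "0 \<le> y" for x y :: real
  proof -
    have sq: "(p + q)\<^sup>2 \<le> 2 * (p\<^sup>2 + q\<^sup>2)" for p q :: real
      using sum_squares_ge_zero[of "p - q" 0] by (simp add: power2_eq_square algebra_simps)
    have "((x + y)\<^sup>2)\<^sup>2 \<le> (2 * (x\<^sup>2 + y\<^sup>2))\<^sup>2" by (rule power_mono[OF sq]) simp
    also have "\<dots> \<le> 8 * (x ^ 4 + y ^ 4)"
      using sq[of "x\<^sup>2" "y\<^sup>2"] unfolding power_mult_distrib[of 2] by simp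
    finally have 4: "((x + y)\<^sup>2)\<^sup>2 \<le> 8 * (x ^ 4 + y ^ 4)" .
    then have "(((x + y)\<^sup>2)\<^sup>2)\<^sup>2 \<le> (8 * (x ^ 4 + y ^ 4))\<^sup>2" by (rule power_mono) simp
    also have "\<dots> \<le> 128 * (x ^ 8 + y ^ 8)"
      using sq[of "x ^ 4" "y ^ 4"] unfolding power_mult_distrib[of 8] by simp
    finally show ?thesis by (simp add: power_mult[symmetric])
  qed
  have "a \<le> 2 * L + u" using a u by linarith
  then have "a ^ 7 \<le> (2 * L + u) ^ 7" by (intro power_mono a)
  \<comment> \<open>Exponent eight lets three squarings separate the two summands.\<close>
  also have "\<dots> \<le> (2 * L + u) ^ 8" using L u by (intro power_increasing) auto
  also have "\<dots> \<le> 2 ^ 7 * ((2 * L) ^ 8 + u ^ 8)" using L u by (intro pow) auto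
  also have "\<dots> \<le> 2 ^ 15 * L ^ 8 + 2 ^ 31 * r" using u8 by (simp add: power_mult_distrib)
  finally show ?thesis .
qed

text \<open>
  The sizes of the cells, divided by their mean \<open>n / K\<close>, have mean one. Hence the terms that are linear in
  these ratios add up to the number \<open>K\<close> of cells.
\<close>

lemma sum_log_power_le:
  fixes P :: "'a set set"
  assumes P: "partition_on W P" "finite P" and W: "finite W" "W \<noteq> {}"
  shows "(\<Sum>A\<in>P. (1 + ln (real (card A))) ^ 7)
           \<le> 2 ^ 32 * real (card P) * log_plus (real (card W) / real (card P)) ^ 8"
proof -
  define n K where "n = real (card W)" and "K = real (card P)"
  define L where "L = log_plus (n / K)"
  have fA: "finite A" "A \<noteq> {}" if "A \<in> P" for A
    using that P(1) W(1) unfolding partition_on_def by (auto intro: finite_subset)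
  have cA: "1 \<le> card A" if "A \<in> P" for A using fA[OF that] by (simp add: Suc_le_eq card_gt_0_iff)
  have "P \<noteq> {}" using P(1) W(2) by (auto simp: partition_on_def)
  then have K: "0 < K" unfolding K_def using P(2) by (simp add: card_gt_0_iff)
  have "card W = (\<Sum>A\<in>P. card A)"
    using P(1) fA unfolding partition_on_def by (metis card_Union_disjoint disjoint_def pairwise_def disjnt_def)
  then have n: "n = (\<Sum>A\<in>P. real (card A))" unfolding n_def by simp
  have "(\<Sum>A\<in>P. 1) \<le> (\<Sum>A\<in>P. real (card A))" using cA by (intro sum_mono) fastforce
  then have Kn: "K \<le> n" unfolding n K_def by simp
  have L1: "1 \<le> L" and Lln: "ln (n / K) \<le> L"
  proof -
    have "0 < n / K" using K Kn by simp
    then show "ln (n / K) \<le> L" unfolding L_def log_plus_def by (subst ln_le_cancel_iff) (auto simp: less_max_iff_disj)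
    have "ln (exp 1) \<le> L" unfolding L_def log_plus_def by (subst ln_le_cancel_iff) (auto simp: less_max_iff_disj)
    then show "1 \<le> L" by simp
  qed
  have "(\<Sum>A\<in>P. (1 + ln (real (card A))) ^ 7) \<le> (\<Sum>A\<in>P. 2 ^ 15 * L ^ 8 + 2 ^ 31 * (real (card A) * K / n))"
  proof (rule sum_mono)
    fix A assume A: "A \<in> P"
    have c: "1 \<le> real (card A)" using cA[OF A] by simp
    have "ln (real (card A) * K / n) = ln (real (card A)) - ln (n / K)"
      using c K Kn by (simp add: ln_mult ln_div)
    then have "1 + ln (real (card A)) \<le> 2 * L + ln (real (card A) * K / n)"
      using L1 Lln by linarith
    then show "(1 + ln (real (card A))) ^ 7 \<le> 2 ^ 15 * L ^ 8 + 2 ^ 31 * (real (card A) * K / n)"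
      using c K Kn L1 by (intro log_power_le_linear) auto
  qed
  also have "\<dots> = K * (2 ^ 15 * L ^ 8) + 2 ^ 31 * ((\<Sum>A\<in>P. real (card A)) * K / n)"
    unfolding sum.distrib sum_distrib_left[symmetric] sum_distrib_right[symmetric] sum_divide_distrib[symmetric]
    by (simp add: K_def)
  also have "(\<Sum>A\<in>P. real (card A)) * K / n = K" unfolding n[symmetric] using K Kn by simp
  also have "K * (2 ^ 15 * L ^ 8) + 2 ^ 31 * K \<le> K * (2 ^ 15 * L ^ 8) + 2 ^ 31 * (K * L ^ 8)"
    using K L1 by (intro add_left_mono mult_left_mono) (auto simp: one_le_power)
  also have "\<dots> \<le> 2 ^ 32 * K * L ^ 8" using K L1 by (simp add: algebra_simps)
  finally show ?thesis unfolding L_def n_def K_def .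
qed

section \<open>The oracle inequality\<close>

text \<open>
  Subtracting a constant preserves isotonicity, so the difference is isotonic on the sheet although
  it need not be isotonic on the whole lattice.
\<close>

lemma sheet_noise_bound:
  assumes A: "two_dim_sheet d n1 A" "A \<noteq> {}" and d: "2 \<le> d" and \<theta>: "\<theta> constant_on A"
  shows "\<exists>T. integrable (gaussian_noise d n1) T
    \<and> (LINT \<epsilon>|gaussian_noise d n1. T \<epsilon>) \<le> 8192 * (1 + ln (real (card A))) ^ 7
    \<and> (\<forall>\<epsilon>. \<forall>h\<in>isotonic d n1.
         2 * (\<Sum>w\<in>A. (h w - \<theta> w) * \<epsilon> w) - (\<Sum>w\<in>A. (h w - \<theta> w)\<^sup>2) \<le> T \<epsilon>)"
proof -
  have AW: "A \<subseteq> lattice_points d n1" using A(1) unfolding two_dim_sheet_def by auto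
  obtain m1 m2 and \<phi> :: "nat \<Rightarrow> nat \<Rightarrow> nat \<Rightarrow> nat"
    where \<phi>: "1 \<le> m1" "1 \<le> m2" "bij_betw (\<lambda>(x, y). \<phi> x y) ({..<m1} \<times> {..<m2}) A"
    and mono: "\<forall>x x' y y'. x \<le> x' \<longrightarrow> y \<le> y' \<longrightarrow> lattice_le d (\<phi> x y) (\<phi> x' y')"
    using two_dim_sheet_parametrization[OF A d] by blast
  obtain T where T: "integrable (iid_normal (lattice_points d n1)) T"
    "(LINT \<epsilon>|iid_normal (lattice_points d n1). T \<epsilon>) \<le> 8192 * (1 + ln (real (card A))) ^ 7"
    "\<forall>\<epsilon> h. (\<forall>x x' y y'. x \<le> x' \<longrightarrow> x' < m1 \<longrightarrow> y \<le> y' \<longrightarrow> y' < m2 \<longrightarrow> h (\<phi> x y) \<le> h (\<phi> x' y'))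
       \<longrightarrow> 2 * (\<Sum>w\<in>A. h w * \<epsilon> w) - (\<Sum>w\<in>A. (h w)\<^sup>2) \<le> T \<epsilon>"
    using gaussian_width_isotone_grid[OF \<phi> AW] by blast
  have "2 * (\<Sum>w\<in>A. (h w - \<theta> w) * \<epsilon> w) - (\<Sum>w\<in>A. (h w - \<theta> w)\<^sup>2) \<le> T \<epsilon>"
    if h: "h \<in> isotonic d n1" for \<epsilon> h
  proof (rule T(3)[rule_format, of "\<lambda>w. h w - \<theta> w"])
    fix x x' y y' :: nat assume xy: "x \<le> x'" "x' < m1" "y \<le> y'" "y' < m2"
    have "\<phi> u v \<in> A" if "u < m1" "v < m2" for u v
      using bij_betwE[OF \<phi>(3)] that by auto
    then have in_A: "\<phi> x y \<in> A" "\<phi> x' y' \<in> A" using xy by auto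
    then have "h (\<phi> x y) \<le> h (\<phi> x' y')" using h mono xy(1,3) AW unfolding isotonic_def by blast
    moreover have "\<theta> (\<phi> x y) = \<theta> (\<phi> x' y')" using \<theta> in_A unfolding constant_on_def by auto
    ultimately show "h (\<phi> x y) - \<theta> (\<phi> x y) \<le> h (\<phi> x' y') - \<theta> (\<phi> x' y')" by simp
  qed
  then show ?thesis using T(1,2) unfolding gaussian_noise_def by blast
qed

text \<open>
  Pathwise, the loss is at most the squared bias plus one noise term for each sheet of an optimal
  partition; the expectation of these terms is then summed over the sheets.
\<close>

lemma risk_bound:
  assumes d: "2 \<le> d" and "2 \<le> n1 ^ d" and \<theta>: "\<theta> \<in> isotonic d n1"
  shows "risk d n1 \<theta>0 \<le> (lattice_norm d n1 (\<lambda>w. \<theta> w - \<theta>0 w))\<^sup>2 / real (n1 ^ d)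
    + 2 ^ 45 * real (sheet_complexity d n1 \<theta>) / real (n1 ^ d)
        * (log_plus (real (n1 ^ d) / real (sheet_complexity d n1 \<theta>))) ^ 8"
proof -
  let ?W = "lattice_points d n1" and ?N = "gaussian_noise d n1"
  define n where "n = real (n1 ^ d)"
  have npos: "0 < n" unfolding n_def using assms(2) by linarith
  have Wne: "?W \<noteq> {}" using assms(2) card_lattice_points[of d n1] by (metis card.empty not_numeral_le_zero)
  obtain P where P: "partition_on ?W P" "finite P" "card P = sheet_complexity d n1 \<theta>"
    and sheets: "\<forall>A\<in>P. two_dim_sheet d n1 A \<and> \<theta> constant_on A"
    using sheet_partition_exists[of d n1 \<theta>] by blast
  define good where "good A T \<longleftrightarrow> integrable ?N T \<and> (LINT \<epsilon>|?N. T \<epsilon>) \<le> 8192 * (1 + ln (real (card A))) ^ 7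
    \<and> (\<forall>\<epsilon>. \<forall>h\<in>isotonic d n1.
         2 * (\<Sum>w\<in>A. (h w - \<theta> w) * \<epsilon> w) - (\<Sum>w\<in>A. (h w - \<theta> w)\<^sup>2) \<le> T \<epsilon>)" for A T
  have "\<exists>T. good A T" if "A \<in> P" for A
  proof -
    have "A \<noteq> {}" using that P(1) unfolding partition_on_def by auto
    then show ?thesis
      using sheet_noise_bound[of d n1 A] sheets that d unfolding good_def by blast
  qed
  then obtain T where "\<And>A. A \<in> P \<Longrightarrow> good A (T A)" by metis
  then have T: "\<And>A. A \<in> P \<Longrightarrow> integrable ?N (T A)"
    "\<And>A. A \<in> P \<Longrightarrow> (LINT \<epsilon>|?N. T A \<epsilon>) \<le> 8192 * (1 + ln (real (card A))) ^ 7"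
    "\<And>A \<epsilon> h. A \<in> P \<Longrightarrow> h \<in> isotonic d n1 \<Longrightarrow>
         2 * (\<Sum>w\<in>A. (h w - \<theta> w) * \<epsilon> w) - (\<Sum>w\<in>A. (h w - \<theta> w)\<^sup>2) \<le> T A \<epsilon>"
    unfolding good_def by blast+
  define D where "D = (\<Sum>w\<in>?W. (\<theta> w - \<theta>0 w)\<^sup>2)"
  define F where "F \<epsilon> = (D + (\<Sum>A\<in>P. T A \<epsilon>)) / n" for \<epsilon>
  define loss where "loss \<epsilon> = (lattice_norm d n1
        (\<lambda>w. lse d n1 (\<lambda>v\<in>?W. \<theta>0 v + \<epsilon> v) w - \<theta>0 w))\<^sup>2 / n" for \<epsilon>
  have "prob_space ?N" unfolding gaussian_noise_def by (rule prob_space_iid_normal)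
  then interpret prob_space ?N .
  have iT: "integrable ?N (\<lambda>\<epsilon>. \<Sum>A\<in>P. T A \<epsilon>)"
    by (intro Bochner_Integration.integrable_sum T(1))
  have iF: "integrable ?N F"
    unfolding F_def using iT by (intro integrable_divide Bochner_Integration.integrable_add) auto
  have partW: "(\<Sum>w\<in>?W. f w) = (\<Sum>A\<in>P. \<Sum>w\<in>A. f w)" for f :: "(nat \<Rightarrow> nat) \<Rightarrow> real"
  proof -
    have "?W = \<Union>P" "\<forall>A\<in>P. finite A" "\<forall>A\<in>P. \<forall>B\<in>P. A \<noteq> B \<longrightarrow> A \<inter> B = {}"
      using P(1) finite_lattice_points[of d n1] unfolding partition_on_def disjoint_def by (auto intro: finite_subset)
    then show ?thesis by (simp add: sum.Union_disjoint)
  qed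
  have le: "loss \<epsilon> \<le> F \<epsilon>" for \<epsilon>
  proof -
    define t where "t = lse d n1 (\<lambda>v\<in>?W. \<theta>0 v + \<epsilon> v)"
    have t: "t \<in> isotonic d n1" unfolding t_def by (rule lse_properties)
    have "0 \<le> (\<Sum>w\<in>?W. (t w - (\<lambda>v\<in>?W. \<theta>0 v + \<epsilon> v) w) * (\<theta> w - t w))"
      unfolding t_def by (rule lse_properties(2)[OF \<theta>])
    then have "0 \<le> (\<Sum>w\<in>?W. (t w - (\<theta>0 w + \<epsilon> w)) * (\<theta> w - t w))" by simp
    from least_squares_oracle[OF this]
    have "(\<Sum>w\<in>?W. (t w - \<theta>0 w)\<^sup>2) \<le> D
        + (2 * (\<Sum>w\<in>?W. (t w - \<theta> w) * \<epsilon> w) - (\<Sum>w\<in>?W. (t w - \<theta> w)\<^sup>2))"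
      unfolding D_def .
    also have "\<dots> = D + (\<Sum>A\<in>P. 2 * (\<Sum>w\<in>A. (t w - \<theta> w) * \<epsilon> w) - (\<Sum>w\<in>A. (t w - \<theta> w)\<^sup>2))"
      unfolding partW sum_subtractf sum_distrib_left ..
    also have "\<dots> \<le> D + (\<Sum>A\<in>P. T A \<epsilon>)"
      by (intro add_left_mono sum_mono T(3) t)
    finally show ?thesis
      unfolding loss_def F_def lattice_norm_square t_def using npos by (intro divide_right_mono) auto
  qed
  have loss0: "0 \<le> loss \<epsilon>" for \<epsilon> unfolding loss_def using npos by simp
  have "risk d n1 \<theta>0 = (LINT \<epsilon>|?N. loss \<epsilon>)" unfolding risk_def loss_def n_def ..
  also have "\<dots> \<le> (LINT \<epsilon>|?N. F \<epsilon>)"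
    using order_trans[OF loss0 le] by (intro integral_mono'[OF iF le])
  also have "\<dots> = (D + (\<Sum>A\<in>P. LINT \<epsilon>|?N. T A \<epsilon>)) / n"
    unfolding F_def using iT T(1) by (simp add: prob_space)
  also have "\<dots> \<le> (D + (\<Sum>A\<in>P. 8192 * (1 + ln (real (card A))) ^ 7)) / n"
    using npos by (intro divide_right_mono add_left_mono sum_mono T(2)) auto
  also have "\<dots> \<le> (D + 2 ^ 45 * real (card P) * log_plus (n / real (card P)) ^ 8) / n"
    using sum_log_power_le[OF P(1,2) finite_lattice_points Wne] npos
    unfolding card_lattice_points n_def[symmetric] sum_distrib_left[symmetric]
    by (intro divide_right_mono) auto
  also have "\<dots> = D / n + 2 ^ 45 * real (card P) / n * log_plus (n / real (card P)) ^ 8"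
    by (simp add: add_divide_distrib)
  finally show ?thesis unfolding D_def lattice_norm_square[symmetric] P(3) n_def .
qed

theorem theorem2:
  shows "\<exists>C::real. C > 0 \<and>
    (\<forall>(d::nat) (n1::nat) (n::nat) (\<theta>0 :: (nat \<Rightarrow> nat) \<Rightarrow> real).
       d \<ge> 2 \<longrightarrow> n \<ge> 2 \<longrightarrow> n = n1 ^ d \<longrightarrow> \<theta>0 \<in> lattice_vectors d n1 \<longrightarrow>
       risk d n1 \<theta>0 \<le>
         (INF \<theta>\<in>isotonic d n1.
            (lattice_norm d n1 (\<lambda>w. \<theta> w - \<theta>0 w))\<^sup>2 / real n
            + C * real (sheet_complexity d n1 \<theta>) / real n
              * (log_plus (real n / real (sheet_complexity d n1 \<theta>))) ^ 8))"
proof (intro exI[of _ "2 ^ 45"] conjI allI impI)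
  fix d n1 n :: nat and \<theta>0 :: "(nat \<Rightarrow> nat) \<Rightarrow> real"
  assume "2 \<le> d" "2 \<le> n" "n = n1 ^ d"
  then show "risk d n1 \<theta>0 \<le>
         (INF \<theta>\<in>isotonic d n1.
            (lattice_norm d n1 (\<lambda>w. \<theta> w - \<theta>0 w))\<^sup>2 / real n
            + 2 ^ 45 * real (sheet_complexity d n1 \<theta>) / real n
              * (log_plus (real n / real (sheet_complexity d n1 \<theta>))) ^ 8)"
    using zero_isotonic[of d n1] risk_bound[of d n1] by (intro cINF_greatest) (blast, simp only:)
qed simp

end
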